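(* Suppose that $n\geq 39k$, and $\mathcal{F},\mathcal{G}\subset\binom{[n]}{k}$ are cross-intersecting with $|\mathcal{F}|,|\mathcal{G}|\geq 2\binom{n-2}{k-2}+4\binom{n-3}{k-3}$. Then $\min\{\varrho(\mathcal{F}),\varrho(\mathcal{G})\}>\frac{1}{2}+\frac{k-2}{2(n-2)}$.
   Context: For positive integers $n\geq k$, $[n]=\{1,\ldots,n\}$ and $\binom{[n]}{k}$ is the collection of all $k$-element subsets of $[n]$. Families $\mathcal{F},\mathcal{G}$ are cross-intersecting if $F\cap G\neq\emptyset$ for all $F\in\mathcal{F}$, $G\in\mathcal{G}$. For a family $\mathcal{H}\subset\binom{[n]}{k}$ and $i\in[n]$ put $\mathcal{H}(i)=\{H\setminus\{i\}: i\in H\in\mathcal{H}\}$ and $\varrho(\mathcal{H})=\max_{1\leq i\leq n}|\mathcal{H}(i)|/|\mathcal{H}|$.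
   Formalization: The formal theorem assumes k ≥ 3: for k = 2 the claim fails (F = {{1,2},{3,4}}, G = {{1,3},{2,4}} have ratio exactly 1/2), and for k = 1 the size bound is 0, so empty families with undefined ϱ are admitted. *)

theory Defs
  imports Complex_Main "HOL-Library.Ramsey"
begin

definition cross_intersecting :: "'a set set \<Rightarrow> 'a set set \<Rightarrow> bool" where
  "cross_intersecting \<F> \<G> \<longleftrightarrow> (\<forall>F\<in>\<F>. \<forall>G\<in>\<G>. F \<inter> G \<noteq> {})"

definition link :: "'a set set \<Rightarrow> 'a \<Rightarrow> 'a set set" where
  "link \<H> i = {H - {i} | H. H \<in> \<H> \<and> i \<in> H}"

(* Meaningful for n > 0 and nonempty families of subsets of {1..n}. *)
definition max_degree_ratio :: "nat \<Rightarrow> nat set set \<Rightarrow> real" where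
  "max_degree_ratio n \<H> = Max ((\<lambda>i. real (card (link \<H> i)) / real (card \<H>)) ` {1..n})"

end

theory Submission
  imports Defs
begin

text \<open>Write \<open>N\<close> for the number of \<open>k\<close>-sets containing a given pair and \<open>eps = (k - 2) / (n - 2) \<le> 1 / 39\<close>, so that
  both families have at least \<open>(2 + 4 * eps) * N\<close> members and the claim is that the ratios exceed \<open>(1 + eps) / 2\<close>.
  Suppose that no element of \<open>\<F>\<close> does so. Then more than \<open>N\<close> sets of \<open>\<F>\<close> avoid any given element; call this spread.

  The engine is compression. If two cross-intersecting families are compressed on \<open>Y\<close>, then two members whose
  common elements all lie in \<open>Y\<close> must overfill an initial segment of \<open>Y\<close>
  (\<open>crowded_of_cross_intersecting\<close>). Hence if one family contains a set with few early elements, all sets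
  of the other family that are disjoint from it outside \<open>Y\<close> have many early elements, and a
  union bound over lattice path crossings shows that such sets are few (\<open>count_exceeds_le\<close>). All bounds are uniform in \<open>k\<close>, as is
  necessary when \<open>n\<close> is only linear in \<open>k\<close>.

  Applied to the complement of one element, this yields that all degrees in \<open>\<G>\<close> are at most
  about \<open>(1 + eps) * N\<close>, less than half of \<open>\<G>\<close> (\<open>degree_le\<close>). So \<open>\<G>\<close> is spread as well and the situation is
  symmetric. Applied to the complement of a pair, it yields that all codegrees are of order \<open>eps * N\<close>
  (\<open>codegree_le\<close>): a pair of larger codegree in \<open>\<G>\<close> would be hit by almost all sets of \<open>\<F>\<close>, and the degrees are too
  small for that.

  Compressing on the whole ground set could destroy spreadness, so the families are shifted only as long as they
  remain spread. When no further shift is possible, every obstructed shift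
  moves between the two elements of a pair that more than half of \<open>\<F>\<close> meets. Three disjoint pairs of this kind
  would produce too many sets hitting two of them, since codegrees are small (\<open>no_three_disjoint_pairs\<close>).
  Therefore at most four elements meet all obstructed pairs, and the families are compressed outside these. A count of
  the sets of \<open>\<G>\<close> by their trace on the four elements, based again on the crowding principle and the codegree
  bound, then gives fewer than \<open>2 * N\<close> sets (\<open>no_compressed_rivals\<close>), a contradiction.\<close>

section \<open>Compressions of set families\<close>

definition push :: "nat \<Rightarrow> nat \<Rightarrow> nat set \<Rightarrow> nat set" where
  "push i j A = (if j \<in> A \<and> i \<notin> A then insert i (A - {j}) else A)"

text \<open>A set is moved only if its image is not already present; this keeps the map injective on the family, so shifting preserves cardinalities.\<close>

definition shift_map :: "nat \<Rightarrow> nat \<Rightarrow> nat set set \<Rightarrow> nat set \<Rightarrow> nat set" where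
  "shift_map i j \<F> A = (if push i j A \<in> \<F> then A else push i j A)"

definition shift :: "nat \<Rightarrow> nat \<Rightarrow> nat set set \<Rightarrow> nat set set" where
  "shift i j \<F> = shift_map i j \<F> ` \<F>"

definition stable :: "nat \<Rightarrow> nat \<Rightarrow> nat set set \<Rightarrow> bool" where
  "stable i j \<F> \<longleftrightarrow> (\<forall>A\<in>\<F>. j \<in> A \<longrightarrow> i \<notin> A \<longrightarrow> insert i (A - {j}) \<in> \<F>)"

definition compressed_on :: "nat set \<Rightarrow> nat set set \<Rightarrow> bool" where
  "compressed_on Y \<F> \<longleftrightarrow> (\<forall>i\<in>Y. \<forall>j\<in>Y. i < j \<longrightarrow> stable i j \<F>)"

lemma inj_on_shift_map: "inj_on (shift_map i j \<F>) \<F>"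
proof (rule inj_onI)
  fix A B assume A: "A \<in> \<F>" and B: "B \<in> \<F>" and eq: "shift_map i j \<F> A = shift_map i j \<F> B"
  consider "push i j A \<in> \<F>" | "push i j B \<in> \<F>" | "push i j A \<notin> \<F>" "push i j B \<notin> \<F>" by blast
  then show "A = B"
  proof cases
    case 1 then show ?thesis using eq A B unfolding shift_map_def by metis
  next
    case 2 then show ?thesis using eq A B unfolding shift_map_def by metis
  next
    case 3
    then have e: "push i j A = push i j B" using eq by (simp add: shift_map_def)
    have ji: "j \<in> A" "i \<notin> A" "j \<in> B" "i \<notin> B"
      using 3 A B unfolding push_def by metis+
    then have "insert i (A - {j}) = insert i (B - {j})" using e by (simp add: push_def)
    then have "A - {j} = B - {j}" using ji by (metis Diff_insert_absorb Diff_iff)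
    then show ?thesis using ji by (metis insert_Diff)
  qed
qed

lemma card_shift: "card (shift i j \<F>) = card \<F>"
  unfolding shift_def by (rule card_image[OF inj_on_shift_map])

lemma card_shift_filter:
  "card {A \<in> shift i j \<F>. P A} = card {A \<in> \<F>. P (shift_map i j \<F> A)}"
proof -
  have "{A \<in> shift i j \<F>. P A} = shift_map i j \<F> ` {A \<in> \<F>. P (shift_map i j \<F> A)}"
    by (auto simp: shift_def)
  then show ?thesis
    by (metis (no_types, lifting) card_image inj_on_shift_map inj_on_subset mem_Collect_eq subsetI)
qed

lemma shift_map_mem_iff:
  assumes "x \<noteq> i" "x \<noteq> j" shows "x \<in> shift_map i j \<F> A \<longleftrightarrow> x \<in> A"
  using assms by (auto simp: shift_map_def push_def)

lemma push_nsets: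
  assumes "A \<in> nsets V k" "i \<in> V" shows "push i j A \<in> nsets V k"
proof (cases "j \<in> A \<and> i \<notin> A")
  case True
  have A: "A \<subseteq> V" "finite A" "card A = k" using assms(1) by (auto simp: nsets_def)
  have "card (insert i (A - {j})) = Suc (card (A - {j}))" using True A(2) by (intro card_insert_disjoint) auto
  also have "\<dots> = card A" using True A(2) by (intro card_Suc_Diff1) auto
  finally show ?thesis using True A assms(2) by (auto simp: push_def nsets_def)
next
  case False
  then have "push i j A = A" unfolding push_def by presburger
  then show ?thesis using assms by simp
qed

lemma shift_nsets:
  assumes "\<F> \<subseteq> nsets V k" "i \<in> V" shows "shift i j \<F> \<subseteq> nsets V k"
  using assms push_nsets by (fastforce simp: shift_def shift_map_def)

lemma cross_intersecting_sym: "cross_intersecting \<F> \<G> \<Longrightarrow> cross_intersecting \<G> \<F>"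
  unfolding cross_intersecting_def by blast

text \<open>The only delicate case is a moved set \<open>A\<close> against an unmoved \<open>B\<close>: if the move destroys the last
  common element \<open>j\<close>, then \<open>B\<close> itself stayed only because its own push was already
  present, and that push misses \<open>A\<close>.\<close>

lemma shift_map_meet:
  assumes cr: "cross_intersecting \<F> \<G>" and A: "A \<in> \<F>" and B: "B \<in> \<G>"
    and mv: "push i j A \<notin> \<F>" and st: "push i j B \<in> \<G>"
  shows "push i j A \<inter> B \<noteq> {}"
proof
  assume e: "push i j A \<inter> B = {}"
  have j: "j \<in> A" "i \<notin> A" using mv A unfolding push_def by metis+
  have p: "push i j A = insert i (A - {j})" using j by (simp add: push_def)
  have d: "i \<notin> B" "(A - {j}) \<inter> B = {}" using e unfolding p by blast+
  have "A \<inter> B \<noteq> {}" using cr A B unfolding cross_intersecting_def by blast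
  then have jB: "j \<in> B" using d by blast
  have q: "push i j B = insert i (B - {j})" using jB d(1) by (simp add: push_def)
  have "A \<inter> insert i (B - {j}) = {}" using d j(2) by blast
  then show False using cr A st unfolding cross_intersecting_def q by blast
qed

lemma cross_intersecting_shift:
  assumes cr: "cross_intersecting \<F> \<G>"
  shows "cross_intersecting (shift i j \<F>) (shift i j \<G>)"
  unfolding cross_intersecting_def
proof (intro ballI)
  fix A' B' assume "A' \<in> shift i j \<F>" "B' \<in> shift i j \<G>"
  then obtain A B where A: "A \<in> \<F>" "A' = shift_map i j \<F> A" and B: "B \<in> \<G>" "B' = shift_map i j \<G> B"
    by (auto simp: shift_def)
  consider "push i j A \<in> \<F>" "push i j B \<in> \<G>" | "push i j A \<in> \<F>" "push i j B \<notin> \<G>"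
    | "push i j A \<notin> \<F>" "push i j B \<in> \<G>" | "push i j A \<notin> \<F>" "push i j B \<notin> \<G>" by blast
  then show "A' \<inter> B' \<noteq> {}"
  proof cases
    case 1 then show ?thesis using A B cr by (auto simp: shift_map_def cross_intersecting_def)
  next
    case 2
    then have "push i j B \<inter> A \<noteq> {}"
      using shift_map_meet[OF cross_intersecting_sym[OF cr] B(1) A(1)] by blast
    then show ?thesis using 2 A B by (auto simp: shift_map_def)
  next
    case 3
    then show ?thesis using shift_map_meet[OF cr A(1) B(1)] A B by (simp add: shift_map_def)
  next
    case 4
    then have "i \<in> push i j A" "i \<in> push i j B"
      using A B unfolding push_def by (metis insertI1)+
    then show ?thesis using 4 A B by (auto simp: shift_map_def)
  qed
qed

text \<open>A potential that drops under every effective shift towards smaller elements.\<close>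

definition weight :: "nat set set \<Rightarrow> nat" where
  "weight \<F> = (\<Sum>A\<in>\<F>. \<Sum>A)"

lemma push_sum:
  assumes "finite A" "i < j" "push i j A \<noteq> A" shows "\<Sum>(push i j A) < \<Sum>A"
proof -
  have j: "j \<in> A" "i \<notin> A" using assms(3) unfolding push_def by metis+
  then have "\<Sum>(push i j A) = i + \<Sum>(A - {j})" using assms(1) by (simp add: push_def)
  also have "\<dots> < j + \<Sum>(A - {j})" using assms(2) by simp
  also have "\<dots> = \<Sum>A" using j assms(1) by (simp add: sum.remove[of A j])
  finally show ?thesis .
qed

lemma weight_shift_less:
  assumes fin: "finite \<F>" "\<And>A. A \<in> \<F> \<Longrightarrow> finite A" and ij: "i < j" and ns: "\<not> stable i j \<F>"
  shows "weight (shift i j \<F>) < weight \<F>"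
proof -
  have "weight (shift i j \<F>) = (\<Sum>A\<in>\<F>. \<Sum>(shift_map i j \<F> A))"
    unfolding weight_def shift_def by (simp add: sum.reindex[OF inj_on_shift_map])
  also have "\<dots> < (\<Sum>A\<in>\<F>. \<Sum>A)"
  proof (rule sum_strict_mono_ex1[OF fin(1)])
    show "\<forall>A\<in>\<F>. \<Sum>(shift_map i j \<F> A) \<le> \<Sum>A"
      using push_sum[OF fin(2) ij] by (fastforce simp: shift_map_def)
    obtain A where A: "A \<in> \<F>" "j \<in> A" "i \<notin> A" "insert i (A - {j}) \<notin> \<F>"
      using ns by (auto simp: stable_def)
    then have "push i j A \<notin> \<F>" by (simp add: push_def)
    moreover have "push i j A \<noteq> A" using A(1) calculation by auto
    ultimately show "\<exists>A\<in>\<F>. \<Sum>(shift_map i j \<F> A) < \<Sum>A"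
      using push_sum[OF fin(2)[OF A(1)] ij] A(1) by (auto simp: shift_map_def)
  qed
  finally show ?thesis by (simp add: weight_def)
qed

text \<open>Shifting ad extremis: instead of iterating shifts as long as they preserve the property \<open>I\<close>,
  choose a pair of least total weight among all pairs with this property.\<close>

lemma ad_extremis:
  assumes I: "I \<F> \<G>"
    and fin: "\<And>\<F> \<G>. I \<F> \<G> \<Longrightarrow> \<F> \<subseteq> nsets V k \<and> \<G> \<subseteq> nsets V k" and V: "finite V"
  obtains \<F>' \<G>' where "I \<F>' \<G>'"
    "\<And>i j. i < j \<Longrightarrow> I (shift i j \<F>') (shift i j \<G>') \<Longrightarrow> stable i j \<F>' \<and> stable i j \<G>'"
proof -
  define W where "W = (\<lambda>p. weight (fst p) + weight (snd p))"
  obtain p where p: "I (fst p) (snd p)" and mn: "\<And>q. I (fst q) (snd q) \<Longrightarrow> W p \<le> W q"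
    using ex_has_least_nat[of "\<lambda>p. I (fst p) (snd p)" "(\<F>, \<G>)" W] I by auto
  define A B where "A = fst p" and "B = snd p"
  have AB: "I A B" "A \<subseteq> nsets V k" "B \<subseteq> nsets V k" using p fin by (auto simp: A_def B_def)
  then have finAB: "finite A" "finite B"
    using V finite_imp_finite_nsets finite_subset by blast+
  have fe: "finite X" if "X \<in> A \<or> X \<in> B" for X
    using that AB by (auto simp: nsets_def)
  have le: "weight (shift i j C) \<le> weight C" if "i < j" "C = A \<or> C = B" for i j C
  proof (cases "stable i j C")
    case True
    then have "shift_map i j C X = X" if "X \<in> C" for X
      using that by (auto simp: stable_def shift_map_def push_def)
    then show ?thesis by (simp add: shift_def)
  next
    case False
    have "finite C" "\<And>X. X \<in> C \<Longrightarrow> finite X" using that(2) finAB fe by auto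
    then show ?thesis using weight_shift_less[of C i j] that(1) False by simp
  qed
  show ?thesis
  proof (rule that[OF AB(1)])
    fix i j :: nat assume ij: "i < j" and Is: "I (shift i j A) (shift i j B)"
    have m: "weight A + weight B \<le> weight (shift i j A) + weight (shift i j B)"
      using mn[of "(shift i j A, shift i j B)"] Is by (simp add: W_def A_def B_def)
    have "weight (shift i j A) = weight A" "weight (shift i j B) = weight B"
      using m le[OF ij, of A] le[OF ij, of B] by auto
    then have "stable i j A" "stable i j B"
      using weight_shift_less[of A i j] weight_shift_less[of B i j] finAB fe ij by auto
    then show "stable i j A \<and> stable i j B" by simp
  qed
qed

text \<open>Shifts outside \<open>X\<close> preserve traces on \<open>X\<close>, so a pair of families with
  prescribed traces can be compressed completely on the complement.\<close>

lemma compress_pair: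
  assumes "\<A> \<subseteq> nsets V k" "\<B> \<subseteq> nsets V k" "finite V" "cross_intersecting \<A> \<B>"
    and "\<forall>A\<in>\<A>. A \<inter> X = P" "\<forall>B\<in>\<B>. B \<inter> X = Q"
  obtains \<A>' \<B>' where "\<A>' \<subseteq> nsets V k" "\<B>' \<subseteq> nsets V k" "card \<A>' = card \<A>" "card \<B>' = card \<B>"
    "cross_intersecting \<A>' \<B>'" "\<forall>A\<in>\<A>'. A \<inter> X = P" "\<forall>B\<in>\<B>'. B \<inter> X = Q"
    "compressed_on (V - X) \<A>'" "compressed_on (V - X) \<B>'"
proof -
  define I where "I = (\<lambda>F G. F \<subseteq> nsets V k \<and> G \<subseteq> nsets V k \<and> card F = card \<A> \<and> card G = card \<B> \<and>
     cross_intersecting F G \<and> (\<forall>A\<in>F. A \<inter> X = P) \<and> (\<forall>B\<in>G. B \<inter> X = Q))"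
  have "I \<A> \<B>" using assms by (simp add: I_def)
  then obtain A B where AB: "I A B"
    and st: "\<And>i j. i < j \<Longrightarrow> I (shift i j A) (shift i j B) \<Longrightarrow> stable i j A \<and> stable i j B"
  proof (rule ad_extremis)
    show "F \<subseteq> nsets V k \<and> G \<subseteq> nsets V k" if "I F G" for F G
      using that by (simp add: I_def)
  qed (use assms(3) in auto)
  have tr: "\<forall>C\<in>shift i j F. C \<inter> X = R" if "\<forall>C\<in>F. C \<inter> X = R" "i \<notin> X" "j \<notin> X" for F R i j
  proof
    fix C assume "C \<in> shift i j F"
    then obtain D where D: "D \<in> F" "C = shift_map i j F D" by (auto simp: shift_def)
    have "x \<in> C \<longleftrightarrow> x \<in> D" if "x \<in> X" for x
      unfolding D(2) using that \<open>i \<notin> X\<close> \<open>j \<notin> X\<close> by (intro shift_map_mem_iff) auto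
    then have "C \<inter> X = D \<inter> X" by auto
    then show "C \<inter> X = R" using that(1) D(1) by simp
  qed
  have "stable i j A \<and> stable i j B" if "i \<in> V - X" "j \<in> V - X" "i < j" for i j
  proof (rule st[OF \<open>i < j\<close>])
    show "I (shift i j A) (shift i j B)"
      unfolding I_def card_shift
    proof (intro conjI)
      show "shift i j A \<subseteq> nsets V k" "shift i j B \<subseteq> nsets V k"
        using AB that(1) shift_nsets by (simp_all add: I_def)
      show "cross_intersecting (shift i j A) (shift i j B)"
        using AB cross_intersecting_shift by (simp add: I_def)
      have h: "i \<notin> X" "j \<notin> X" "\<forall>C\<in>A. C \<inter> X = P" "\<forall>C\<in>B. C \<inter> X = Q"
        using that(1,2) AB by (simp_all add: I_def)
      show "\<forall>C\<in>shift i j A. C \<inter> X = P" using h(3,1,2) by (rule tr)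
      show "\<forall>C\<in>shift i j B. C \<inter> X = Q" using h(4,1,2) by (rule tr)
      show "card A = card \<A>" "card B = card \<B>" using AB by (simp_all add: I_def)
    qed
  qed
  then show ?thesis using that[of A B] AB by (simp add: I_def compressed_on_def)
qed

section \<open>Initial segments and compressed cross-intersecting families\<close>

definition below :: "nat set \<Rightarrow> nat \<Rightarrow> nat set" where
  "below Y z = {y \<in> Y. y \<le> z}"

definition initial :: "nat set \<Rightarrow> nat \<Rightarrow> nat set" where
  "initial Y s = {y \<in> Y. card (below Y y) \<le> s}"

lemma initial_subset: "initial Y s \<subseteq> Y" by (auto simp: initial_def)

lemma initial_mono: "s \<le> t \<Longrightarrow> initial Y s \<subseteq> initial Y t" by (auto simp: initial_def)

lemma card_below_less:
  assumes "finite Y" "y \<in> Y" "z \<in> Y" "y < z" shows "card (below Y y) < card (below Y z)"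
proof (rule psubset_card_mono)
  show "finite (below Y z)" using assms(1) by (simp add: below_def)
  have "z \<in> below Y z" "z \<notin> below Y y" using assms by (auto simp: below_def)
  moreover have "below Y y \<subseteq> below Y z" using assms(4) by (auto simp: below_def)
  ultimately show "below Y y \<subset> below Y z" by auto
qed

lemma initial_eq_below:
  assumes "finite Y" "z \<in> Y" shows "initial Y (card (below Y z)) = below Y z"
proof -
  have "card (below Y y) \<le> card (below Y z) \<longleftrightarrow> y \<le> z" if "y \<in> Y" for y
    using card_below_less[OF assms(1) assms(2) that] card_below_less[OF assms(1) that assms(2)]
    by (metis leD leI le_less)
  then show ?thesis by (auto simp: initial_def below_def)
qed

lemma card_initial:
  assumes "finite Y" shows "card (initial Y s) = min s (card Y)"
proof -
  have inj: "inj_on (\<lambda>y. card (below Y y)) Y"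
    by (rule inj_onI) (metis assms card_below_less less_irrefl linorder_neqE_nat)
  have sub: "(\<lambda>y. card (below Y y)) ` Y \<subseteq> {1..card Y}"
  proof
    fix c assume "c \<in> (\<lambda>y. card (below Y y)) ` Y"
    then obtain y where y: "y \<in> Y" "c = card (below Y y)" by auto
    have "y \<in> below Y y" "finite (below Y y)" using y assms by (auto simp: below_def)
    then have "0 < c" unfolding y(2) card_gt_0_iff by blast
    then have "1 \<le> c" by simp
    moreover have "c \<le> card Y" using y assms by (auto simp: below_def intro: card_mono)
    ultimately show "c \<in> {1..card Y}" by simp
  qed
  have im: "(\<lambda>y. card (below Y y)) ` Y = {1..card Y}"
    by (rule card_subset_eq[OF _ sub]) (simp_all add: card_image[OF inj])
  have "(\<lambda>y. card (below Y y)) ` initial Y s = {1..min s (card Y)}"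
  proof -
    have "(\<lambda>y. card (below Y y)) ` initial Y s = (\<lambda>y. card (below Y y)) ` Y \<inter> {..s}"
      by (auto simp: initial_def)
    then show ?thesis unfolding im by auto
  qed
  moreover have "card ((\<lambda>y. card (below Y y)) ` initial Y s) = card (initial Y s)"
    by (rule card_image) (rule inj_on_subset[OF inj initial_subset])
  ultimately show ?thesis by simp
qed

text \<open>Two disjoint sets share the \<open>s\<close> places of an initial segment, so a crowded pair cannot be disjoint
  on \<open>Y\<close>. Conversely, members of compressed
  cross-intersecting families that meet only inside \<open>Y\<close> are crowded (\<open>crowded_of_cross_intersecting\<close>).\<close>

definition crowded :: "nat set \<Rightarrow> nat set \<Rightarrow> nat set \<Rightarrow> bool" where
  "crowded Y F G \<longleftrightarrow> (\<exists>s. s < card (F \<inter> initial Y s) + card (G \<inter> initial Y s))"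

lemma crowded_sym: "crowded Y F G \<Longrightarrow> crowded Y G F"
  unfolding crowded_def by (metis add.commute)

lemma exists_free_before_common:
  assumes "finite Y" "y \<in> Y" "y \<in> F" "y \<in> G"
    and "card (F \<inter> below Y y) + card (G \<inter> below Y y) \<le> card (below Y y)"
  shows "\<exists>w\<in>Y. w < y \<and> w \<notin> F \<and> w \<notin> G"
proof (rule ccontr)
  assume no: "\<not> ?thesis"
  have fin: "finite (below Y y)" using assms(1) by (simp add: below_def)
  have "below Y y \<subseteq> F \<inter> below Y y \<union> G \<inter> below Y y"
    using no assms(3) unfolding below_def by (auto simp: order_le_less)
  then have "card (below Y y) \<le> card (F \<inter> below Y y \<union> G \<inter> below Y y)"
    using fin by (intro card_mono) auto
  moreover have "card (F \<inter> below Y y \<union> G \<inter> below Y y) + card ((F \<inter> below Y y) \<inter> (G \<inter> below Y y))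
      = card (F \<inter> below Y y) + card (G \<inter> below Y y)"
    using fin by (intro card_Un_Int[symmetric]) auto
  moreover have "0 < card ((F \<inter> below Y y) \<inter> (G \<inter> below Y y))"
    using assms fin by (subst card_gt_0_iff) (auto simp: below_def)
  ultimately show False using assms(5) by linarith
qed

text \<open>If no initial segment of \<open>Y\<close> is overfull, the common elements of \<open>F\<close> and \<open>G\<close> can be removed
  one at a time: the least common element \<open>y\<close> of \<open>F\<close> is moved to the last position \<open>z\<close> before it that is free
  in both. Every element strictly between them lies in exactly one of the two
  sets, so the segments that receive an additional element had room for it.\<close>

lemma crowded_of_cross_intersecting:
  assumes comp: "compressed_on Y \<F>" and cr: "cross_intersecting \<F> \<G>" and fin: "finite Y"
    and F: "F \<in> \<F>" and G: "G \<in> \<G>" and FG: "F \<inter> G \<subseteq> Y"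
  shows "crowded Y F G"
proof -
  have "\<exists>z\<in>Y. card (below Y z) < card (F \<inter> below Y z) + card (G \<inter> below Y z)"
    using F FG
  proof (induction "card (F \<inter> G)" arbitrary: F rule: less_induct)
    case less
    show ?case
    proof (rule ccontr)
      assume "\<not> ?case"
      then have room: "card (F \<inter> below Y z) + card (G \<inter> below Y z) \<le> card (below Y z)" if "z \<in> Y" for z
        using that by (meson not_le)
      have fFG: "finite (F \<inter> G)" using less.prems(2) fin finite_subset by blast
      have ne: "F \<inter> G \<noteq> {}" using cr less.prems(1) G unfolding cross_intersecting_def by blast
      define y where "y = Min (F \<inter> G)"
      have y: "y \<in> F" "y \<in> G" "y \<in> Y"
        using Min_in[OF fFG ne] less.prems(2) by (auto simp: y_def)
      have ymin: "y \<le> w" if "w \<in> F" "w \<in> G" for w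
        using that fFG by (simp add: y_def)
      define M where "M = {w \<in> Y. w < y \<and> w \<notin> F \<and> w \<notin> G}"
      have "M \<noteq> {}" "finite M"
        using exists_free_before_common[OF fin y(3,1,2) room[OF y(3)]] fin by (auto simp: M_def)
      define z where "z = Max M"
      have "z \<in> M" using Max_in \<open>M \<noteq> {}\<close> \<open>finite M\<close> by (simp add: z_def)
      then have z: "z \<in> Y" "z < y" "z \<notin> F" "z \<notin> G" by (auto simp: M_def)
      have full: "w \<in> F \<or> w \<in> G" if "w \<in> Y" "z < w" "w < y" for w
      proof (rule ccontr)
        assume "\<not> ?thesis"
        then have "w \<in> M" using that by (simp add: M_def)
        then have "w \<le> z" using \<open>finite M\<close> by (simp add: z_def)
        then show False using that(2) by simp
      qed
      define F' where "F' = insert z (F - {y})"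
      have F': "F' \<in> \<F>"
        using comp less.prems(1) y z unfolding compressed_on_def stable_def F'_def by blast
      have int: "F' \<inter> G = F \<inter> G - {y}" using z by (auto simp: F'_def)
      have lt: "card (F' \<inter> G) < card (F \<inter> G)"
        unfolding int using fFG y by (intro card_Diff1_less) auto
      have sub: "F' \<inter> G \<subseteq> Y" using int less.prems(2) by auto
      obtain u where u: "u \<in> Y" "card (below Y u) < card (F' \<inter> below Y u) + card (G \<inter> below Y u)"
        using less.hyps[OF lt F' sub] by blast
      have fb: "finite (below Y v)" for v using fin by (simp add: below_def)
      consider "u < z" | "z \<le> u" "u < y" | "y \<le> u" by linarith
      then show False
      proof cases
        case 1
        then have "F' \<inter> below Y u = F \<inter> below Y u" using z by (auto simp: F'_def below_def)
        then show False using u room[OF u(1)] by simp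
      next
        case 2
        have e: "F' \<inter> below Y u = insert z (F \<inter> below Y u)" using 2 z by (auto simp: F'_def below_def)
        have c1: "card (F' \<inter> below Y u) = Suc (card (F \<inter> below Y u))"
          unfolding e using z fb by (intro card_insert_disjoint) auto
        define D where "D = below Y y - below Y u"
        have D: "w \<in> D \<longleftrightarrow> w \<in> Y \<and> u < w \<and> w \<le> y" for w by (auto simp: D_def below_def)
        have bu: "below Y u \<subseteq> below Y y" using 2 by (auto simp: below_def)
        have split: "card (H \<inter> below Y y) = card (H \<inter> below Y u) + card (H \<inter> D)" for H
        proof -
          have "H \<inter> below Y y = (H \<inter> below Y u) \<union> (H \<inter> D)" using bu by (auto simp: D_def)
          moreover have "(H \<inter> below Y u) \<inter> (H \<inter> D) = {}" by (auto simp: D_def)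
          ultimately show ?thesis using fb by (simp add: card_Un_disjoint D_def)
        qed
        have "D \<subseteq> F \<inter> D \<union> G \<inter> D"
        proof
          fix w assume w: "w \<in> D"
          show "w \<in> F \<inter> D \<union> G \<inter> D"
          proof (cases "w = y")
            case True then show ?thesis using y w by simp
          next
            case False
            then have "w \<in> F \<or> w \<in> G" using w 2 D full[of w] by simp
            then show ?thesis using w by auto
          qed
        qed
        then have "card D \<le> card (F \<inter> D \<union> G \<inter> D)"
          using fb by (intro card_mono) (auto simp: D_def)
        moreover have "card (F \<inter> D \<union> G \<inter> D) + card ((F \<inter> D) \<inter> (G \<inter> D)) = card (F \<inter> D) + card (G \<inter> D)"
          using fb by (intro card_Un_Int[symmetric]) (auto simp: D_def)
        moreover have "0 < card ((F \<inter> D) \<inter> (G \<inter> D))"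
        proof -
          have "y \<in> (F \<inter> D) \<inter> (G \<inter> D)" using y 2 D by simp
          moreover have "finite ((F \<inter> D) \<inter> (G \<inter> D))" using fb by (auto simp: D_def)
          ultimately show ?thesis by (metis card_gt_0_iff empty_iff)
        qed
        moreover have "card (below Y y) = card (below Y u) + card D"
          using split[of UNIV] by simp
        ultimately show False
          using room[OF y(3)] split[of F] split[of G] u(2) c1 by linarith
      next
        case 3
        have e: "F' \<inter> below Y u = insert z ((F \<inter> below Y u) - {y})"
          using 3 z by (auto simp: F'_def below_def)
        have "card (F' \<inter> below Y u) = Suc (card ((F \<inter> below Y u) - {y}))"
          unfolding e using z fb by (intro card_insert_disjoint) auto
        also have "\<dots> = card (F \<inter> below Y u)"
          using y 3 fb by (intro card_Suc_Diff1) (auto simp: below_def)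
        finally show False using u room[OF u(1)] by simp
      qed
    qed
  qed
  then show ?thesis unfolding crowded_def using initial_eq_below[OF fin] by metis
qed

text \<open>If the elements of \<open>Y\<close> are read in increasing order as steps of a lattice path that goes up at the
  members of \<open>K\<close>, this says that the path crosses a line of slope one half at time \<open>2 * t + a\<close>
  for some \<open>t \<ge> t0\<close>. For \<open>a = b = 1\<close> and \<open>t0 = 0\<close> it is the event that members
  of \<open>K\<close> are in the strict majority in some initial segment. The lower bound \<open>t0\<close> allows early
  crossings, which need exact counts, to be treated apart from the negligible later ones.\<close>

definition exceeds :: "nat set \<Rightarrow> nat \<Rightarrow> nat \<Rightarrow> nat \<Rightarrow> nat set \<Rightarrow> bool" where
  "exceeds Y a b t0 K \<longleftrightarrow> (\<exists>t\<ge>t0. t + b \<le> card (K \<inter> initial Y (2 * t + a)))"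

lemma not_exceedsD:
  "\<not> exceeds Y a b t0 K \<Longrightarrow> t0 \<le> t \<Longrightarrow> card (K \<inter> initial Y (2 * t + a)) < t + b"
  unfolding exceeds_def by (meson not_le)

lemma exceeds_cases:
  assumes "exceeds Y a b t0 K"
  shows "t0 + b \<le> card (K \<inter> initial Y (2 * t0 + a)) \<or> exceeds Y a b (Suc t0) K"
  using assms unfolding exceeds_def by (metis le_eq_less_or_eq Suc_leI)

context
  fixes Y :: "nat set"
  assumes fin: "finite Y"
begin

lemma card_Int_initial_le: "card (K \<inter> initial Y s) \<le> s"
proof -
  have "card (K \<inter> initial Y s) \<le> card (initial Y s)"
    by (rule card_mono) (use fin finite_subset[OF initial_subset] in auto)
  then show ?thesis using card_initial[OF fin, of s] by simp
qed

lemma card_Int_initial_mono: "s \<le> t \<Longrightarrow> card (K \<inter> initial Y s) \<le> card (K \<inter> initial Y t)"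
  using initial_mono[of s t Y] finite_subset[OF initial_subset[of Y t] fin]
  by (intro card_mono) auto

text \<open>For a crowded pair the number of places in an initial segment can be divided between \<open>F\<close> and \<open>G\<close> in
  advance, and one of them exceeds its share. The following three divisions are used. In the first, each set
  gets half of the places, the odd place going to \<open>G\<close>. In the second, \<open>G\<close> gets one or two places more than \<open>F\<close>. In
  the third, \<open>F\<close> misses the first element of \<open>Y\<close>, and from the fifth place on \<open>F\<close> gets
  one or two places more than \<open>G\<close>.\<close>

lemma crowded_exceeds0:
  assumes "crowded Y F G" shows "exceeds Y 1 1 0 F \<or> exceeds Y 0 1 1 G"
proof (rule ccontr)
  assume no: "\<not> ?thesis"
  have f: "card (F \<inter> initial Y (2 * t + 1)) \<le> t" for t
    using not_exceedsD[of Y 1 1 0 F t] no by simp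
  have g: "card (G \<inter> initial Y (2 * t)) \<le> t" for t
    using not_exceedsD[of Y 0 1 1 G t] no card_Int_initial_le[of G 0] by (cases "t = 0") auto
  obtain s where s: "s < card (F \<inter> initial Y s) + card (G \<inter> initial Y s)"
    using assms by (auto simp: crowded_def)
  show False
  proof (cases "even s")
    case True
    then obtain t where "s = 2 * t" by auto
    then show False using f[of t] g[of t] s card_Int_initial_mono[of "2*t" "2*t+1" F] by simp
  next
    case False
    then obtain t where "s = 2 * t + 1" using oddE by blast
    then show False using f[of t] g[of "Suc t"] s card_Int_initial_mono[of "2*t+1" "2*Suc t" G] by simp
  qed
qed

lemma crowded_exceeds1:
  assumes "crowded Y F G" shows "exceeds Y 0 0 1 F \<or> exceeds Y 1 2 1 G"
proof (rule ccontr)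
  assume no: "\<not> ?thesis"
  have f: "card (F \<inter> initial Y (2 * Suc t)) \<le> t" for t
    using not_exceedsD[of Y 0 0 1 F "Suc t"] no by simp
  have g: "card (G \<inter> initial Y (2 * t + 1)) \<le> t + 1" for t
    using not_exceedsD[of Y 1 2 1 G t] no card_Int_initial_le[of G 1] by (cases "t = 0") auto
  obtain s where s: "s < card (F \<inter> initial Y s) + card (G \<inter> initial Y s)"
    using assms by (auto simp: crowded_def)
  show False
  proof (cases "even s")
    case True
    then obtain t where st: "s = 2 * t" by auto
    show False
    proof (cases t)
      case 0 then show False using s st card_Int_initial_le[of F 0] card_Int_initial_le[of G 0] by simp
    next
      case (Suc r)
      then show False using f[of r] g[of t] s st card_Int_initial_mono[of "2*t" "2*t+1" G] by simp
    qed
  next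
    case False
    then obtain t where "s = 2 * t + 1" using oddE by blast
    then show False using f[of t] g[of t] s card_Int_initial_mono[of "2*t+1" "2*Suc t" F] by simp
  qed
qed

lemma crowded_exceeds2:
  assumes "crowded Y F G" "F \<inter> initial Y 1 = {}"
  shows "exceeds Y 1 2 2 F \<or> exceeds Y 0 0 2 G"
proof (rule ccontr)
  assume no: "\<not> ?thesis"
  have f: "card (F \<inter> initial Y (2 * t + 1)) \<le> t + 1" if "t \<ge> 2" for t
    using not_exceedsD[of Y 1 2 2 F t] no that by simp
  have g: "card (G \<inter> initial Y (2 * t)) < t" if "t \<ge> 2" for t
    using not_exceedsD[of Y 0 0 2 G t] no that by simp
  obtain s where s: "s < card (F \<inter> initial Y s) + card (G \<inter> initial Y s)"
    using assms by (auto simp: crowded_def)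
  have f1: "card (F \<inter> initial Y s) \<le> s - 1" if "s \<ge> 1"
  proof -
    have fi: "finite (initial Y s)" using finite_subset[OF initial_subset fin] .
    have "F \<inter> initial Y s \<subseteq> initial Y s - initial Y 1" using assms(2) by auto
    then have "card (F \<inter> initial Y s) \<le> card (initial Y s - initial Y 1)"
      using fi by (intro card_mono) auto
    also have "\<dots> = card (initial Y s) - card (initial Y 1)"
      using fi initial_mono[OF that] by (intro card_Diff_subset) (auto intro: finite_subset)
    also have "\<dots> \<le> s - 1" using card_initial[OF fin] that by simp
    finally show ?thesis .
  qed
  consider "s = 0" | "s \<ge> 1" "s \<le> 4" | t where "t \<ge> 2" "s = 2 * t + 1" | t where "t \<ge> 3" "s = 2 * t"
  proof -
    assume *: "s = 0 \<Longrightarrow> thesis" "1 \<le> s \<Longrightarrow> s \<le> 4 \<Longrightarrow> thesis"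
      "\<And>t. t \<ge> 2 \<Longrightarrow> s = 2 * t + 1 \<Longrightarrow> thesis" "\<And>t. t \<ge> 3 \<Longrightarrow> s = 2 * t \<Longrightarrow> thesis"
    show thesis
    proof (cases "s \<le> 4")
      case True then show thesis using *(1,2) by (cases "s = 0") auto
    next
      case False
      then show thesis using *(3)[of "s div 2"] *(4)[of "s div 2"] by (cases "even s") auto
    qed
  qed
  then show False
  proof cases
    case 1 then show False using s card_Int_initial_le[of F 0] card_Int_initial_le[of G 0] by simp
  next
    case 2
    then show False using s f1 g[of 2] card_Int_initial_mono[of s 4 G] by simp
  next
    case (3 t)
    then show False using f[of t] g[of "Suc t"] s card_Int_initial_mono[of "2*t+1" "2*Suc t" G] by simp
  next
    case (4 t)
    then show False using f[of t] g[of t] s card_Int_initial_mono[of "2*t" "2*t+1" F] by simp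
  qed
qed

end

section \<open>Counting sets that contain many early elements\<close>

lemma binomial_left_mono: "m \<le> n \<Longrightarrow> m choose j \<le> n choose j"
proof (induction rule: dec_induct)
  case (step n)
  have "n choose j \<le> Suc n choose j" by (cases j) auto
  then show ?case using step.IH by (rule order_trans[rotated])
qed simp

text \<open>Near the middle of Pascal's triangle two rows down means a factor of about four; the factor six leaves
  room for the off-centre entries in small rows.\<close>

lemma binomial_step_le:
  assumes "j \<le> m" "(m + 2) * (m + 1) \<le> 6 * (j + 1) * (m + 1 - j)"
  shows "(m + 2) choose (j + 1) \<le> 6 * (m choose j)"
proof -
  define A B C where "A = Suc (Suc m) choose Suc j" and "B = Suc m choose j" and "C = m choose j"
  have e1: "(j + 1) * A = (m + 2) * B"
    unfolding A_def B_def using Suc_times_binomial[of j "Suc m"]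
    by (simp del: binomial_Suc_Suc mult_Suc mult_Suc_right)
  have e2: "(m + 1 - j) * B = (m + 1) * C"
    unfolding B_def C_def using binomial_absorb_comp[of "Suc m" j] 
    by (simp del: binomial_Suc_Suc mult_Suc mult_Suc_right)
  have "((j + 1) * (m + 1 - j)) * A = (m + 1 - j) * ((j + 1) * A)" by (simp only: mult_ac)
  also have "\<dots> = (m + 2) * ((m + 1 - j) * B)" unfolding e1 by (simp only: mult_ac)
  also have "\<dots> = ((m + 2) * (m + 1)) * C" unfolding e2 by (simp only: mult_ac)
  also have "\<dots> \<le> (6 * (j + 1) * (m + 1 - j)) * C" using assms(2) by (rule mult_right_mono) simp
  also have "\<dots> = ((j + 1) * (m + 1 - j)) * (6 * C)" by (simp only: mult_ac)
  finally have le: "((j + 1) * (m + 1 - j)) * A \<le> ((j + 1) * (m + 1 - j)) * (6 * C)" .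
  have "0 < (j + 1) * (m + 1 - j)" using assms(1) by simp
  with le have "A \<le> 6 * C" by (simp only: mult_le_cancel1)
  then show ?thesis unfolding A_def C_def by (simp del: binomial_Suc_Suc)
qed

text \<open>The hypotheses of \<open>binomial_step_le\<close> for the four families of lines to which the bound
  on \<open>exceeds\<close> is applied.\<close>

lemma growth_ballot:
  "t + 1 \<le> 2 * t + 1 \<and> (2 * t + 1 + 2) * (2 * t + 1 + 1) \<le> 6 * (t + 1 + 1) * (2 * t + 1 + 1 - (t + 1))"
  "1 \<le> t \<Longrightarrow> t + 1 \<le> 2 * t + 0 \<and> (2 * t + 0 + 2) * (2 * t + 0 + 1) \<le> 6 * (t + 1 + 1) * (2 * t + 0 + 1 - (t + 1))"
  "t + 0 \<le> 2 * t + 0 \<and> (2 * t + 0 + 2) * (2 * t + 0 + 1) \<le> 6 * (t + 0 + 1) * (2 * t + 0 + 1 - (t + 0))"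
  "1 \<le> t \<Longrightarrow> t + 2 \<le> 2 * t + 1 \<and> (2 * t + 1 + 2) * (2 * t + 1 + 1) \<le> 6 * (t + 2 + 1) * (2 * t + 1 + 1 - (t + 2))"
  for t :: nat
proof -
  have d: "2 * t + 1 + 1 - (t + 1) = t + 1" "2 * t + 0 + 1 - (t + 1) = t"
    "2 * t + 0 + 1 - (t + 0) = t + 1" "2 * t + 1 + 1 - (t + 2) = t" by auto
  show "t + 1 \<le> 2 * t + 1 \<and> (2 * t + 1 + 2) * (2 * t + 1 + 1) \<le> 6 * (t + 1 + 1) * (2 * t + 1 + 1 - (t + 1))"
    unfolding d by (simp add: algebra_simps)
  show "t + 0 \<le> 2 * t + 0 \<and> (2 * t + 0 + 2) * (2 * t + 0 + 1) \<le> 6 * (t + 0 + 1) * (2 * t + 0 + 1 - (t + 0))"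
    unfolding d by (simp add: algebra_simps)
  assume t: "1 \<le> t"
  then have tt: "t \<le> t * t" by simp
  show "t + 1 \<le> 2 * t + 0 \<and> (2 * t + 0 + 2) * (2 * t + 0 + 1) \<le> 6 * (t + 1 + 1) * (2 * t + 0 + 1 - (t + 1))"
    unfolding d using t tt by (simp add: algebra_simps)
  show "t + 2 \<le> 2 * t + 1 \<and> (2 * t + 1 + 2) * (2 * t + 1 + 1) \<le> 6 * (t + 2 + 1) * (2 * t + 1 + 1 - (t + 2))"
    unfolding d using t tt by (simp add: algebra_simps)
qed

lemma geometric_sum_le:
  fixes x :: real assumes "0 \<le> x" "39 * x \<le> 6" shows "(\<Sum>q<r. x ^ q) \<le> 6 / 5"
proof -
  have "(1 - x) * (\<Sum>q<r. x ^ q) = 1 - x ^ r" by (simp add: one_diff_power_eq)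
  also have "\<dots> \<le> 1" using assms(1) by simp
  finally have *: "(1 - x) * (\<Sum>q<r. x ^ q) \<le> 1" .
  have "(33 / 39) * (\<Sum>q<r. x ^ q) \<le> (1 - x) * (\<Sum>q<r. x ^ q)"
    using assms by (intro mult_right_mono sum_nonneg) auto
  with * show ?thesis by simp
qed

text \<open>Counts are real numbers since they are compared with real multiples of binomial coefficients.\<close>

definition cnt :: "nat set set \<Rightarrow> (nat set \<Rightarrow> bool) \<Rightarrow> real" where
  "cnt \<F> P = real (card {K \<in> \<F>. P K})"

lemma cnt_mono:
  assumes "finite \<K>" "\<F> \<subseteq> \<K>" "\<And>K. K \<in> \<F> \<Longrightarrow> P K \<Longrightarrow> Q K"
  shows "cnt \<F> P \<le> cnt \<K> Q"
  unfolding cnt_def using assms by (intro of_nat_mono card_mono) auto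

lemma cnt_add_le:
  assumes "finite \<K>" "\<F> \<subseteq> \<K>" "\<And>K. K \<in> \<F> \<Longrightarrow> P K \<Longrightarrow> Q K \<or> R K"
  shows "cnt \<F> P \<le> cnt \<K> Q + cnt \<K> R"
proof -
  have "card {K \<in> \<F>. P K} \<le> card ({K \<in> \<K>. Q K} \<union> {K \<in> \<K>. R K})"
    using assms by (intro card_mono) auto
  also have "\<dots> \<le> card {K \<in> \<K>. Q K} + card {K \<in> \<K>. R K}" by (rule card_Un_le)
  finally show ?thesis unfolding cnt_def by simp
qed

lemma cnt_not: "finite \<F> \<Longrightarrow> cnt \<F> (\<lambda>K. \<not> P K) = real (card \<F>) - cnt \<F> P"
proof -
  assume "finite \<F>"
  then have "card {K \<in> \<F>. P K} + card {K \<in> \<F>. \<not> P K} = card ({K \<in> \<F>. P K} \<union> {K \<in> \<F>. \<not> P K})"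
    by (intro card_Un_disjoint[symmetric]) auto
  moreover have "{K \<in> \<F>. P K} \<union> {K \<in> \<F>. \<not> P K} = \<F>" by auto
  ultimately show ?thesis unfolding cnt_def by simp
qed

lemma cnt_split: "finite \<F> \<Longrightarrow> cnt \<F> Q = cnt \<F> (\<lambda>K. Q K \<and> P K) + cnt \<F> (\<lambda>K. Q K \<and> \<not> P K)"
proof -
  assume "finite \<F>"
  then have "card ({K \<in> \<F>. Q K \<and> P K} \<union> {K \<in> \<F>. Q K \<and> \<not> P K})
      = card {K \<in> \<F>. Q K \<and> P K} + card {K \<in> \<F>. Q K \<and> \<not> P K}"
    by (intro card_Un_disjoint) auto
  moreover have "{K \<in> \<F>. Q K \<and> P K} \<union> {K \<in> \<F>. Q K \<and> \<not> P K} = {K \<in> \<F>. Q K}" by auto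
  ultimately show ?thesis unfolding cnt_def by simp
qed

lemma cnt_sum: "finite \<F> \<Longrightarrow> cnt \<F> P = (\<Sum>K\<in>\<F>. of_bool (P K))"
  unfolding cnt_def by (simp add: of_bool_def sum.If_cases Int_def)

lemma cnt_UN_le:
  assumes "finite \<F>" "finite I" "\<And>K. K \<in> \<F> \<Longrightarrow> P K \<Longrightarrow> \<exists>q\<in>I. Q q K"
  shows "cnt \<F> P \<le> (\<Sum>q\<in>I. cnt \<F> (Q q))"
proof -
  have "card {K \<in> \<F>. P K} \<le> card (\<Union>q\<in>I. {K \<in> \<F>. Q q K})"
    using assms by (intro card_mono) auto
  also have "\<dots> \<le> (\<Sum>q\<in>I. card {K \<in> \<F>. Q q K})" by (rule card_UN_le[OF assms(2)])
  finally show ?thesis unfolding cnt_def of_nat_sum[symmetric] by (simp only: of_nat_le_iff)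
qed

lemma card_nsets_supersets:
  assumes "finite V" "T \<subseteq> V" "card T \<le> k"
  shows "card {K \<in> nsets V k. T \<subseteq> K} = (card V - card T) choose (k - card T)"
proof -
  have fT: "finite T" using assms finite_subset by blast
  have "{K \<in> nsets V k. T \<subseteq> K} = (\<union>) T ` {L. L \<subseteq> V - T \<and> card L = k - card T}"
  proof (intro equalityI subsetI)
    fix K assume "K \<in> {K \<in> nsets V k. T \<subseteq> K}"
    then have K: "K \<subseteq> V" "finite K" "card K = k" "T \<subseteq> K" by (auto simp: nsets_def)
    have "K = T \<union> (K - T)" using K(4) by auto
    moreover have "K - T \<subseteq> V - T" using K(1) by auto
    moreover have "card (K - T) = k - card T" using K fT by (simp add: card_Diff_subset)
    ultimately show "K \<in> (\<union>) T ` {L. L \<subseteq> V - T \<and> card L = k - card T}" by blast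
  next
    fix K assume "K \<in> (\<union>) T ` {L. L \<subseteq> V - T \<and> card L = k - card T}"
    then obtain L where L: "L \<subseteq> V - T" "card L = k - card T" "K = T \<union> L" by auto
    have fL: "finite L" using L(1) assms(1) by (meson finite_Diff finite_subset)
    have "card K = card T + card L"
      unfolding L(3) using L(1) fT fL by (intro card_Un_disjoint) auto
    then show "K \<in> {K \<in> nsets V k. T \<subseteq> K}"
      using L assms fT fL by (auto simp: nsets_def)
  qed
  moreover have "inj_on ((\<union>) T) {L. L \<subseteq> V - T \<and> card L = k - card T}"
    by (rule inj_onI) blast
  ultimately have "card {K \<in> nsets V k. T \<subseteq> K} = card {L. L \<subseteq> V - T \<and> card L = k - card T}"
    by (simp add: card_image)
  also have "\<dots> = (card V - card T) choose (k - card T)"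
    using assms fT by (simp add: n_subsets card_Diff_subset)
  finally show ?thesis .
qed

lemma subset_if_card_Int: "finite S \<Longrightarrow> card S \<le> card (K \<inter> S) \<Longrightarrow> S \<subseteq> K"
  by (metis Int_lower2 card_seteq inf.absorb_iff2)

lemma card_link: "card (link \<H> i) = card {H \<in> \<H>. i \<in> H}"
proof -
  have "link \<H> i = (\<lambda>H. H - {i}) ` {H \<in> \<H>. i \<in> H}" by (auto simp: link_def)
  moreover have "inj_on (\<lambda>H. H - {i}) {H \<in> \<H>. i \<in> H}"
    by (rule inj_onI) (metis insert_Diff mem_Collect_eq)
  ultimately show ?thesis by (simp add: card_image)
qed

text \<open>All sizes are measured in terms of \<open>N\<close>, the number of \<open>k\<close>-sets that contain a given pair. One more prescribed
  element costs a factor of at most \<open>eps\<close>, and exactly \<open>eps\<close> for the third one. As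
  \<open>eps \<le> 1 / 39\<close>, bounds of order \<open>eps\<^sup>2 * N\<close> are negligible against \<open>eps * N\<close>.\<close>

locale sparse_layer =
  fixes n k :: nat
  assumes k3: "3 \<le> k" and nk: "39 * k \<le> n"
begin

definition N :: real where "N = real ((n - 2) choose (k - 2))"
definition eps :: real where "eps = (real k - 2) / (real n - 2)"

abbreviation layer :: "nat set set" where "layer \<equiv> nsets {1..n} k"

lemma finite_layer: "finite layer" by (rule finite_imp_finite_nsets) simp

lemma eps_pos: "0 < eps" using k3 nk by (simp add: eps_def)

lemma eps_le: "39 * eps \<le> 1"
proof -
  have "39 * real k \<le> real n" using nk by (metis of_nat_le_iff of_nat_mult of_nat_numeral)
  then show ?thesis using k3 nk by (simp add: eps_def field_simps)
qed

lemma N_pos: "0 < N" using k3 nk by (simp add: N_def)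

lemma binomial_descend:
  assumes "Suc i \<le> k - 2"
  shows "real ((n - 2 - Suc i) choose (k - 2 - Suc i)) * real (n - 2 - i)
    = real (k - 2 - i) * real ((n - 2 - i) choose (k - 2 - i))"
proof -
  have 1: "Suc (n - 2 - Suc i) = n - 2 - i" "Suc (k - 2 - Suc i) = k - 2 - i"
    using assms nk by auto
  have h: "(k - 2 - i) * ((n - 2 - i) choose (k - 2 - i)) = (n - 2 - i) * ((n - 2 - Suc i) choose (k - 2 - Suc i))"
    using Suc_times_binomial[of "k - 2 - Suc i" "n - 2 - Suc i"] unfolding 1 .
  show ?thesis using arg_cong[OF h, of real] by (simp only: of_nat_mult mult.commute)
qed

lemma binomial_descend_le:
  "i \<le> k - 2 \<Longrightarrow> real ((n - 2 - i) choose (k - 2 - i)) \<le> eps ^ i * N"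
proof (induction i)
  case 0 then show ?case by (simp add: N_def)
next
  case (Suc i)
  have kn: "real k < real n" "2 < real k" using k3 nk by simp_all
  have pos: "0 < real (n - 2 - i)" using Suc.prems nk by simp
  have "real (k - 2 - i) \<le> eps * real (n - 2 - i)"
  proof -
    have r: "real (k - 2 - i) = real k - 2 - real i" "real (n - 2 - i) = real n - 2 - real i"
      using Suc.prems nk by auto
    have "(real k - 2 - real i) * (real n - 2) \<le> (real k - 2) * (real n - 2 - real i)"
      using kn mult_left_mono[of "real k" "real n" "real i"] by (simp add: algebra_simps)
    then show ?thesis unfolding r eps_def using kn by (simp add: field_simps)
  qed
  then have "real ((n - 2 - Suc i) choose (k - 2 - Suc i)) * real (n - 2 - i)
      \<le> (eps * real (n - 2 - i)) * real ((n - 2 - i) choose (k - 2 - i))"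
    unfolding binomial_descend[OF Suc.prems] by (rule mult_right_mono) simp
  then have "real ((n - 2 - Suc i) choose (k - 2 - Suc i)) * real (n - 2 - i)
      \<le> (eps * real ((n - 2 - i) choose (k - 2 - i))) * real (n - 2 - i)"
    by (simp only: mult_ac)
  then have "real ((n - 2 - Suc i) choose (k - 2 - Suc i)) \<le> eps * real ((n - 2 - i) choose (k - 2 - i))"
    by (rule mult_right_le_imp_le[OF _ pos])
  also have "\<dots> \<le> eps * (eps ^ i * N)" using Suc eps_pos by (intro mult_left_mono) auto
  finally show ?case by simp
qed

lemma card_third: "real ((n - 3) choose (k - 3)) = eps * N"
proof -
  have "real ((n - 3) choose (k - 3)) * (real n - 2) = (real k - 2) * N"
    using binomial_descend[of 0] k3 nk by (simp add: N_def of_nat_diff numeral_eq_Suc)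
  then show ?thesis using nk k3 by (simp add: eps_def field_simps)
qed

lemma count_supersets_le:
  assumes "T \<subseteq> {1..n}" "card T = i + 2"
  shows "cnt layer (\<lambda>K. T \<subseteq> K) \<le> eps ^ i * N"
proof (cases "card T \<le> k")
  case True
  then have "card {K \<in> layer. T \<subseteq> K} = (n - 2 - i) choose (k - 2 - i)"
    using card_nsets_supersets[of "{1..n}" T k] assms by simp
  then show ?thesis using binomial_descend_le[of i] True assms unfolding cnt_def by simp
next
  case False
  have "{K \<in> layer. T \<subseteq> K} = {}"
    using False card_mono[of _ T] by (fastforce simp: nsets_def)
  then have "cnt layer (\<lambda>K. T \<subseteq> K) = 0" unfolding cnt_def by (simp only: card.empty of_nat_0)
  then show ?thesis using eps_pos N_pos by simp
qed

lemma count_supersets2: "T \<subseteq> {1..n} \<Longrightarrow> card T = 2 \<Longrightarrow> cnt layer (\<lambda>K. T \<subseteq> K) = N"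
  using card_nsets_supersets[of "{1..n}" T k] k3 by (simp add: cnt_def N_def)

lemma count_supersets3: "T \<subseteq> {1..n} \<Longrightarrow> card T = 3 \<Longrightarrow> cnt layer (\<lambda>K. T \<subseteq> K) = eps * N"
  using card_nsets_supersets[of "{1..n}" T k] k3 card_third by (simp add: cnt_def)

lemma count_heavy_le:
  assumes "T \<subseteq> {1..n}" "S \<subseteq> {1..n}" "T \<inter> S = {}" "card T + j = i + 2"
  shows "cnt layer (\<lambda>K. T \<subseteq> K \<and> j \<le> card (K \<inter> S)) \<le> real (card S choose j) * (eps ^ i * N)"
proof -
  have fS: "finite S" and fT: "finite T" using assms finite_subset by blast+
  have fin: "finite (nsets S j)" using fS by (rule finite_imp_finite_nsets)
  have "cnt layer (\<lambda>K. T \<subseteq> K \<and> j \<le> card (K \<inter> S)) \<le> (\<Sum>J\<in>nsets S j. cnt layer (\<lambda>K. T \<union> J \<subseteq> K))"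
  proof (rule cnt_UN_le[OF finite_layer fin])
    fix K assume "K \<in> layer" and K: "T \<subseteq> K \<and> j \<le> card (K \<inter> S)"
    obtain J where J: "J \<subseteq> K \<inter> S" "card J = j" "finite J"
      using obtain_subset_with_card_n[of j "K \<inter> S"] K by blast
    then show "\<exists>J\<in>nsets S j. T \<union> J \<subseteq> K" using K by (auto simp: nsets_def)
  qed
  also have "\<dots> \<le> (\<Sum>J\<in>nsets S j. eps ^ i * N)"
  proof (rule sum_mono)
    fix J assume "J \<in> nsets S j"
    then have J: "J \<subseteq> S" "finite J" "card J = j" by (auto simp: nsets_def)
    have "card (T \<union> J) = card T + card J"
      using J assms(3) fT by (intro card_Un_disjoint) auto
    then show "cnt layer (\<lambda>K. T \<union> J \<subseteq> K) \<le> eps ^ i * N"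
      using J assms by (intro count_supersets_le) auto
  qed
  also have "\<dots> = real (card (nsets S j)) * (eps ^ i * N)" by simp
  also have "card (nsets S j) = card {L. L \<subseteq> S \<and> card L = j}"
    using fS finite_subset by (intro arg_cong[of _ _ card]) (auto simp: nsets_def)
  also have "\<dots> = card S choose j" by (rule n_subsets[OF fS])
  finally show ?thesis .
qed

text \<open>A union bound over the threshold that is met. Successive binomial coefficients grow by a factor of
  at most \<open>6\<close> while the number of supersets shrinks by \<open>eps\<close>, so the first term dominates.\<close>

lemma count_exceeds_le:
  assumes Y: "Y \<subseteq> {1..n}" and T: "T \<subseteq> {1..n}" "T \<inter> Y = {}" and i: "card T + t0 + b = i + 2"
    and growth: "\<And>t. t0 \<le> t \<Longrightarrow> t + b \<le> 2 * t + a \<and>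
      (2 * t + a + 2) * (2 * t + a + 1) \<le> 6 * (t + b + 1) * (2 * t + a + 1 - (t + b))"
  shows "cnt layer (\<lambda>K. T \<subseteq> K \<and> exceeds Y a b t0 K)
    \<le> 6 / 5 * real ((2 * t0 + a) choose (t0 + b)) * (eps ^ i * N)"
proof -
  have finY: "finite Y" using Y finite_subset by blast
  define C where "C = real ((2 * t0 + a) choose (t0 + b))"
  have nat_binom: "(2 * (t0 + q) + a) choose (t0 + q + b) \<le> 6 ^ q * ((2 * t0 + a) choose (t0 + b))" for q
  proof (induction q)
    case (Suc q)
    have e: "2 * (t0 + Suc q) + a = 2 * (t0 + q) + a + 2" "t0 + Suc q + b = t0 + q + b + 1" by auto
    have "(2 * (t0 + Suc q) + a) choose (t0 + Suc q + b)
        = (2 * (t0 + q) + a + 2) choose (t0 + q + b + 1)" unfolding e ..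
    also have "\<dots> \<le> 6 * ((2 * (t0 + q) + a) choose (t0 + q + b))"
      using growth[of "t0 + q"] by (intro binomial_step_le) auto
    also have "\<dots> \<le> 6 ^ Suc q * ((2 * t0 + a) choose (t0 + b))" using Suc by simp
    finally show ?case .
  qed simp
  have binom: "real ((2 * (t0 + q) + a) choose (t0 + q + b)) \<le> 6 ^ q * C" for q
    using of_nat_mono[OF nat_binom[of q], where 'a = real]
    unfolding C_def by (simp only: of_nat_mult of_nat_power of_nat_numeral)
  have term_le: "cnt layer (\<lambda>K. T \<subseteq> K \<and> t0 + q + b \<le> card (K \<inter> initial Y (2 * (t0 + q) + a)))
      \<le> C * (eps ^ i * N) * (6 * eps) ^ q" for q
  proof -
    let ?S = "initial Y (2 * (t0 + q) + a)"
    have S: "?S \<subseteq> {1..n}" "T \<inter> ?S = {}" using initial_subset Y T by blast+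
    have cS: "card ?S \<le> 2 * (t0 + q) + a" using card_initial[OF finY] by simp
    have "cnt layer (\<lambda>K. T \<subseteq> K \<and> t0 + q + b \<le> card (K \<inter> ?S))
        \<le> real (card ?S choose (t0 + q + b)) * (eps ^ (i + q) * N)"
      using i by (intro count_heavy_le T S) auto
    also have "\<dots> \<le> (6 ^ q * C) * (eps ^ (i + q) * N)"
    proof (rule mult_right_mono)
      show "real (card ?S choose (t0 + q + b)) \<le> 6 ^ q * C"
        using binomial_left_mono[OF cS, of "t0 + q + b"] binom[of q] by linarith
      show "0 \<le> eps ^ (i + q) * N" using eps_pos N_pos by simp
    qed
    also have "\<dots> = C * (eps ^ i * N) * (6 * eps) ^ q" by (simp add: power_add power_mult_distrib)
    finally show ?thesis .
  qed
  have "cnt layer (\<lambda>K. T \<subseteq> K \<and> exceeds Y a b t0 K)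
    \<le> (\<Sum>q\<in>{..<Suc k}. cnt layer (\<lambda>K. T \<subseteq> K \<and> t0 + q + b \<le> card (K \<inter> initial Y (2 * (t0 + q) + a))))"
  proof (rule cnt_UN_le[OF finite_layer])
    fix K assume "K \<in> layer" and K: "T \<subseteq> K \<and> exceeds Y a b t0 K"
    then obtain t where t: "t0 \<le> t" "t + b \<le> card (K \<inter> initial Y (2 * t + a))"
      by (auto simp: exceeds_def)
    have "card (K \<inter> initial Y (2 * t + a)) \<le> k"
      using \<open>K \<in> layer\<close> card_mono[of K "K \<inter> initial Y (2 * t + a)"] by (auto simp: nsets_def)
    then have "t - t0 \<in> {..<Suc k}" using t(2) by simp
    moreover have "t0 + (t - t0) = t" using t(1) by simp
    ultimately show "\<exists>q\<in>{..<Suc k}. T \<subseteq> K \<and> t0 + q + b \<le> card (K \<inter> initial Y (2 * (t0 + q) + a))"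
      using K t(2) by (intro bexI[of _ "t - t0"]) simp_all
  qed simp
  also have "\<dots> \<le> (\<Sum>q\<in>{..<Suc k}. C * (eps ^ i * N) * (6 * eps) ^ q)"
    by (rule sum_mono) (rule term_le)
  also have "\<dots> = C * (eps ^ i * N) * (\<Sum>q<Suc k. (6 * eps) ^ q)"
    by (simp only: sum_distrib_left)
  also have "\<dots> \<le> C * (eps ^ i * N) * (6 / 5)"
    using eps_pos eps_le N_pos by (intro mult_left_mono geometric_sum_le) (auto simp: C_def)
  finally show ?thesis unfolding C_def by (simp only: mult_ac)
qed

section \<open>Degrees and codegrees\<close>

text \<open>This is \<open>(1 - eps) / 2\<close> times the least size allowed for the two families, hence a lower bound for the
  number of sets that avoid a given element if no element has degree ratio above \<open>(1 + eps) / 2\<close>.\<close>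

definition beta :: real where "beta = N + eps * N - 2 * (eps\<^sup>2 * N)"

lemma sizes: "0 < eps * N" "0 < eps\<^sup>2 * N" "39 * (eps * N) \<le> N" "39 * (eps\<^sup>2 * N) \<le> eps * N"
proof -
  show "0 < eps * N" "0 < eps\<^sup>2 * N" using eps_pos N_pos by auto
  show "39 * (eps * N) \<le> N" using mult_right_mono[OF eps_le, of N] N_pos by simp
  show "39 * (eps\<^sup>2 * N) \<le> eps * N"
    using mult_right_mono[OF eps_le, of "eps * N"] N_pos eps_pos by (simp add: power2_eq_square)
qed

lemma count_exceeds:
  assumes "Y \<subseteq> {1..n}" "T \<subseteq> {1..n}" "T \<inter> Y = {}"
  shows "card T + t0 = i + 1 \<Longrightarrow> cnt layer (\<lambda>K. T \<subseteq> K \<and> exceeds Y 1 1 t0 K)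
      \<le> 6 / 5 * real ((2 * t0 + 1) choose (t0 + 1)) * (eps ^ i * N)"
    and "card T + t0 = i + 1 \<Longrightarrow> 1 \<le> t0 \<Longrightarrow> cnt layer (\<lambda>K. T \<subseteq> K \<and> exceeds Y 0 1 t0 K)
      \<le> 6 / 5 * real ((2 * t0 + 0) choose (t0 + 1)) * (eps ^ i * N)"
    and "card T + t0 = i + 2 \<Longrightarrow> cnt layer (\<lambda>K. T \<subseteq> K \<and> exceeds Y 0 0 t0 K)
      \<le> 6 / 5 * real ((2 * t0 + 0) choose (t0 + 0)) * (eps ^ i * N)"
    and "card T + t0 = i \<Longrightarrow> 1 \<le> t0 \<Longrightarrow> cnt layer (\<lambda>K. T \<subseteq> K \<and> exceeds Y 1 2 t0 K)
      \<le> 6 / 5 * real ((2 * t0 + 1) choose (t0 + 2)) * (eps ^ i * N)"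
proof -
  show "card T + t0 = i + 1 \<Longrightarrow> cnt layer (\<lambda>K. T \<subseteq> K \<and> exceeds Y 1 1 t0 K)
      \<le> 6 / 5 * real ((2 * t0 + 1) choose (t0 + 1)) * (eps ^ i * N)"
    by (intro count_exceeds_le assms growth_ballot) auto
  show "card T + t0 = i + 1 \<Longrightarrow> 1 \<le> t0 \<Longrightarrow> cnt layer (\<lambda>K. T \<subseteq> K \<and> exceeds Y 0 1 t0 K)
      \<le> 6 / 5 * real ((2 * t0 + 0) choose (t0 + 1)) * (eps ^ i * N)"
    by (intro count_exceeds_le assms growth_ballot) auto
  show "card T + t0 = i + 2 \<Longrightarrow> cnt layer (\<lambda>K. T \<subseteq> K \<and> exceeds Y 0 0 t0 K)
      \<le> 6 / 5 * real ((2 * t0 + 0) choose (t0 + 0)) * (eps ^ i * N)"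
    by (intro count_exceeds_le assms growth_ballot) auto
  show "card T + t0 = i \<Longrightarrow> 1 \<le> t0 \<Longrightarrow> cnt layer (\<lambda>K. T \<subseteq> K \<and> exceeds Y 1 2 t0 K)
      \<le> 6 / 5 * real ((2 * t0 + 1) choose (t0 + 2)) * (eps ^ i * N)"
    by (intro count_exceeds_le assms growth_ballot) auto
qed

lemma card_initial_exact:
  assumes "Y \<subseteq> {1..n}" "s \<le> card Y" shows "card (initial Y s) = s" "finite (initial Y s)"
proof -
  have "finite Y" using assms(1) finite_subset by blast
  then show "card (initial Y s) = s" "finite (initial Y s)"
    using card_initial[of Y s] assms(2) finite_subset[OF initial_subset] by auto
qed

lemma card_initial_diff:
  assumes "Y \<subseteq> {1..n}" "s \<le> t" "t \<le> card Y"
  shows "card (initial Y t - initial Y s) = t - s" "finite (initial Y t - initial Y s)"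
proof -
  have "finite (initial Y s)" "finite (initial Y t)" "card (initial Y s) = s" "card (initial Y t) = t"
    using card_initial_exact assms by (meson order_trans)+
  then show "card (initial Y t - initial Y s) = t - s" "finite (initial Y t - initial Y s)"
    using initial_mono[OF assms(2)] by (auto simp: card_Diff_subset)
qed

lemma card_Int_initial_split:
  assumes "Y \<subseteq> {1..n}" "s \<le> t"
  shows "card (K \<inter> initial Y t) = card (K \<inter> initial Y s) + card (K \<inter> (initial Y t - initial Y s))"
proof -
  have "finite (initial Y t)" "finite (initial Y s)"
    using assms(1) finite_subset[OF initial_subset] finite_subset[OF assms(1)] by blast+
  moreover have "K \<inter> initial Y t = K \<inter> initial Y s \<union> K \<inter> (initial Y t - initial Y s)"
    using initial_mono[OF assms(2)] by auto
  moreover have "(K \<inter> initial Y s) \<inter> (K \<inter> (initial Y t - initial Y s)) = {}" by auto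
  ultimately show ?thesis by (metis card_Un_disjoint finite_Diff finite_Int)
qed

text \<open>The sets of \<open>\<F>\<close> avoiding \<open>x\<close> and the sets of \<open>\<G>\<close> containing \<open>x\<close> can be compressed on
  the complement of \<open>x\<close>. Slightly more than \<open>N\<close> sets do not all contain a fixed pair (only
  \<open>N - eps * N\<close> sets avoid \<open>x\<close> and contain a given pair), so some compressed set of the first kind
  is low enough to force every set of the second kind to be high: besides \<open>x\<close> these contain the first element
  of \<open>Y\<close>, or the next two, or belong to a negligible remainder.

  The estimate is tight. About \<open>N + eps * N\<close> sets avoid \<open>x\<close> and contain the first two elements of \<open>Y\<close>, or the
  first, third and fourth, or the second, third and fourth; for \<open>k = 3\<close> their number is the least integer above
  \<open>beta\<close>. So a crossing count alone does not exclude that all compressed sets of the first kind are of this form. But if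
  some of them avoid the first element of \<open>Y\<close>, then two of the first four elements are forced on
  all sets containing \<open>x\<close>, up to later crossings, and those are few; this is the second case below.\<close>

lemma degree_le:
  assumes F: "\<F> \<subseteq> layer" and G: "\<G> \<subseteq> layer" and cr: "cross_intersecting \<F> \<G>"
    and x: "x \<in> {1..n}" and miss: "beta \<le> cnt \<F> (\<lambda>K. x \<notin> K)"
  shows "cnt \<G> (\<lambda>K. x \<in> K) \<le> N + eps * N + 12 * (eps\<^sup>2 * N)"
proof -
  define Y where "Y = {1..n} - {x}"
  have Y: "Y \<subseteq> {1..n}" "finite Y" "x \<notin> Y" by (auto simp: Y_def)
  have "card Y = n - 1" using x by (simp add: Y_def)
  then have cY: "5 \<le> card Y" using nk k3 by simp
  have subs: "{K \<in> \<F>. x \<notin> K} \<subseteq> layer" "{K \<in> \<G>. x \<in> K} \<subseteq> layer" using F G by auto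
  have cr': "cross_intersecting {K \<in> \<F>. x \<notin> K} {K \<in> \<G>. x \<in> K}"
    using cr by (simp add: cross_intersecting_def)
  have tr: "\<forall>A\<in>{K \<in> \<F>. x \<notin> K}. A \<inter> {x} = {}" "\<forall>B\<in>{K \<in> \<G>. x \<in> K}. B \<inter> {x} = {x}" by auto
  obtain A B where A: "A \<subseteq> layer" and B: "B \<subseteq> layer"
    and cA: "card A = card {K \<in> \<F>. x \<notin> K}" and cB: "card B = card {K \<in> \<G>. x \<in> K}"
    and AB: "cross_intersecting A B" and tA: "\<forall>a\<in>A. a \<inter> {x} = {}" and tB: "\<forall>b\<in>B. b \<inter> {x} = {x}"
    and comp: "compressed_on Y A" "compressed_on Y B"
    unfolding Y_def by (rule compress_pair[OF subs finite_atLeastAtMost cr' tr])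
  have szA: "beta \<le> real (card A)" using miss cA by (simp add: cnt_def)
  have szB: "cnt \<G> (\<lambda>K. x \<in> K) = real (card B)" using cB by (simp add: cnt_def)
  have finA: "finite A" and finB: "finite B" using A B finite_layer finite_subset by blast+
  have crowd: "crowded Y a b" if "a \<in> A" "b \<in> B" for a b
  proof (rule crowded_of_cross_intersecting[OF comp(1) AB Y(2) that])
    have "a \<subseteq> {1..n}" "x \<notin> a" using that A tA by (auto simp: nsets_def)
    then show "a \<inter> b \<subseteq> Y" by (auto simp: Y_def)
  qed
  have xB: "x \<in> b" if "b \<in> B" for b using tB that by auto
  define I where "I = initial Y"
  have Isub: "I s \<subseteq> Y" for s by (simp add: I_def initial_subset)
  have Icard: "card (I s) = s" "finite (I s)" if "s \<le> 5" for s
    using card_initial_exact[OF Y(1)] that cY by (auto simp: I_def)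
  have Idiff: "card (I t - I s) = t - s" "finite (I t - I s)" if "s \<le> t" "t \<le> 5" for s t
    using card_initial_diff[OF Y(1)] that cY by (auto simp: I_def)
  have Isplit: "card (K \<inter> I t) = card (K \<inter> I s) + card (K \<inter> (I t - I s))" if "s \<le> t" for K s t
    using card_Int_initial_split[OF Y(1) that] by (simp add: I_def)
  have xT: "{x} \<subseteq> {1..n}" "{x} \<inter> Y = {}" using x Y by auto
  \<comment> \<open>The first two cases bound \<open>B\<close>; in the third, \<open>A\<close> would be too small.\<close>
  consider (1) a where "a \<in> A" "\<not> exceeds Y 0 1 1 a"
    | (2) a where "a \<in> A" "a \<inter> I 1 = {}" "\<not> exceeds Y 1 2 2 a"
    | (3) "\<And>a. a \<in> A \<Longrightarrow> exceeds Y 0 1 1 a" "\<And>a. a \<in> A \<Longrightarrow> a \<inter> I 1 \<noteq> {} \<or> exceeds Y 1 2 2 a"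
    by blast
  then show ?thesis
  proof cases
    case 1
    have ex: "exceeds Y 1 1 0 b" if "b \<in> B" for b
      using crowded_exceeds0[OF Y(2) crowded_sym[OF crowd[OF 1(1) that]]] 1(2) by blast
    have *: "{x} \<union> I 1 \<subseteq> b \<or> {x} \<union> (I 3 - I 1) \<subseteq> b \<or> ({x} \<subseteq> b \<and> exceeds Y 1 1 2 b)" if "b \<in> B" for b
    proof (cases "1 \<le> card (b \<inter> I 1)")
      case True
      then show ?thesis using xB[OF that] subset_if_card_Int[of "I 1" b] Icard[of 1] by simp
    next
      case False
      then have "exceeds Y 1 1 1 b" using exceeds_cases[OF ex[OF that]] by (simp add: I_def)
      then consider "2 \<le> card (b \<inter> I 3)" | "exceeds Y 1 1 2 b"
        using exceeds_cases[of Y 1 1 1 b] by (auto simp: I_def numeral_eq_Suc)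
      then show ?thesis
      proof cases
        case 1
        then have "2 \<le> card (b \<inter> (I 3 - I 1))" using False Isplit[of 1 3 b] by simp
        then show ?thesis using xB[OF that] subset_if_card_Int[of "I 3 - I 1" b] Idiff[of 1 3] by simp
      qed (use xB[OF that] in simp)
    qed
    have "real (card B) = cnt B (\<lambda>_. True)" by (simp add: cnt_def)
    also have "\<dots> \<le> cnt layer (\<lambda>K. {x} \<union> I 1 \<subseteq> K)
        + cnt layer (\<lambda>K. {x} \<union> (I 3 - I 1) \<subseteq> K \<or> ({x} \<subseteq> K \<and> exceeds Y 1 1 2 K))"
      using * by (intro cnt_add_le finite_layer B) simp
    also have "cnt layer (\<lambda>K. {x} \<union> (I 3 - I 1) \<subseteq> K \<or> ({x} \<subseteq> K \<and> exceeds Y 1 1 2 K))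
        \<le> cnt layer (\<lambda>K. {x} \<union> (I 3 - I 1) \<subseteq> K) + cnt layer (\<lambda>K. {x} \<subseteq> K \<and> exceeds Y 1 1 2 K)"
      by (intro cnt_add_le finite_layer order_refl)
    also have "cnt layer (\<lambda>K. {x} \<union> I 1 \<subseteq> K) = N"
    proof (rule count_supersets2)
      show "{x} \<union> I 1 \<subseteq> {1..n}" using Isub[of 1] Y x by auto
      have "x \<notin> I 1" using Isub[of 1] Y by auto
      then show "card ({x} \<union> I 1) = 2" using Icard[of 1] by simp
    qed
    also have "cnt layer (\<lambda>K. {x} \<union> (I 3 - I 1) \<subseteq> K) = eps * N"
    proof (rule count_supersets3)
      show "{x} \<union> (I 3 - I 1) \<subseteq> {1..n}" using Isub[of 3] Y x by auto
      have "x \<notin> I 3 - I 1" using Isub[of 3] Y by auto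
      then show "card ({x} \<union> (I 3 - I 1)) = 3" using Idiff[of 1 3] by simp
    qed
    also have "cnt layer (\<lambda>K. {x} \<subseteq> K \<and> exceeds Y 1 1 2 K) \<le> 12 * (eps\<^sup>2 * N)"
      using count_exceeds(1)[OF Y(1) xT, of 2 2] by (simp add: eval_nat_numeral)
    finally show ?thesis using szB by simp
  next
    case 2
    have ex: "exceeds Y 0 0 2 b" if "b \<in> B" for b
      using crowded_exceeds2[OF Y(2) crowd[OF 2(1) that]] 2(2,3) by (simp add: I_def)
    have "real (card B) = cnt B (\<lambda>_. True)" by (simp add: cnt_def)
    also have "\<dots> \<le> cnt layer (\<lambda>K. {x} \<subseteq> K \<and> exceeds Y 0 0 2 K)"
      using ex xB by (intro cnt_mono finite_layer B) simp
    also have "\<dots> \<le> 36 / 5 * (eps * N)"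
      using count_exceeds(3)[OF Y(1) xT, of 2 1] by (simp add: eval_nat_numeral)
    finally show ?thesis using szB sizes by simp
  next
    case 3
    have *: "(I 2 \<subseteq> a \<and> x \<notin> a) \<or> I 1 \<union> (I 4 - I 2) \<subseteq> a \<or> ({} \<subseteq> a \<and> exceeds Y 0 1 3 a) \<or> ({} \<subseteq> a \<and> exceeds Y 1 2 2 a)"
      if "a \<in> A" for a
    proof (cases "2 \<le> card (a \<inter> I 2)")
      case True
      then show ?thesis using tA that subset_if_card_Int[of "I 2" a] Icard[of 2] by auto
    next
      case False
      then have "exceeds Y 0 1 2 a" using exceeds_cases[OF 3(1)[OF that]] by (simp add: I_def numeral_eq_Suc)
      then consider "3 \<le> card (a \<inter> I 4)" | "exceeds Y 0 1 3 a"
        using exceeds_cases[of Y 0 1 2 a] by (auto simp: I_def numeral_eq_Suc)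
      then show ?thesis
      proof cases
        case 1
        show ?thesis
        proof (cases "exceeds Y 1 2 2 a")
          case ne: False
          then have "a \<inter> I 1 \<noteq> {}" using 3(2)[OF that] by blast
          then have "1 \<le> card (a \<inter> I 1)" using Icard(2)[of 1] by (simp add: Suc_le_eq card_gt_0_iff)
          then have "I 1 \<subseteq> a" using subset_if_card_Int[of "I 1" a] Icard[of 1] by simp
          moreover have "2 \<le> card (a \<inter> (I 4 - I 2))" using 1 False Isplit[of 2 4 a] by simp
          then have "I 4 - I 2 \<subseteq> a" using subset_if_card_Int[of "I 4 - I 2" a] Idiff[of 2 4] by simp
          ultimately show ?thesis by simp
        qed simp
      qed simp
    qed
    have "real (card A) = cnt A (\<lambda>_. True)" by (simp add: cnt_def)
    also have "\<dots> \<le> cnt layer (\<lambda>K. I 2 \<subseteq> K \<and> x \<notin> K) + cnt layer (\<lambda>K. I 1 \<union> (I 4 - I 2) \<subseteq> K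
       \<or> ({} \<subseteq> K \<and> exceeds Y 0 1 3 K) \<or> ({} \<subseteq> K \<and> exceeds Y 1 2 2 K))"
      using * by (intro cnt_add_le finite_layer A) simp
    also have "cnt layer (\<lambda>K. I 1 \<union> (I 4 - I 2) \<subseteq> K \<or> ({} \<subseteq> K \<and> exceeds Y 0 1 3 K) \<or> ({} \<subseteq> K \<and> exceeds Y 1 2 2 K))
       \<le> cnt layer (\<lambda>K. I 1 \<union> (I 4 - I 2) \<subseteq> K)
         + cnt layer (\<lambda>K. ({} \<subseteq> K \<and> exceeds Y 0 1 3 K) \<or> ({} \<subseteq> K \<and> exceeds Y 1 2 2 K))"
      by (intro cnt_add_le finite_layer order_refl)
    also have "cnt layer (\<lambda>K. ({} \<subseteq> K \<and> exceeds Y 0 1 3 K) \<or> ({} \<subseteq> K \<and> exceeds Y 1 2 2 K))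
       \<le> cnt layer (\<lambda>K. {} \<subseteq> K \<and> exceeds Y 0 1 3 K) + cnt layer (\<lambda>K. {} \<subseteq> K \<and> exceeds Y 1 2 2 K)"
      by (intro cnt_add_le finite_layer order_refl)
    also have "cnt layer (\<lambda>K. {} \<subseteq> K \<and> exceeds Y 0 1 3 K) \<le> 18 * (eps\<^sup>2 * N)"
      using count_exceeds(2)[OF Y(1), of "{}" 3 2] by (simp add: eval_nat_numeral)
    also have "cnt layer (\<lambda>K. {} \<subseteq> K \<and> exceeds Y 1 2 2 K) \<le> 6 * (eps\<^sup>2 * N)"
      using count_exceeds(4)[OF Y(1), of "{}" 2 2] by (simp add: eval_nat_numeral)
    also have "cnt layer (\<lambda>K. I 1 \<union> (I 4 - I 2) \<subseteq> K) = eps * N"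
    proof (rule count_supersets3)
      show "I 1 \<union> (I 4 - I 2) \<subseteq> {1..n}" using Isub[of 1] Isub[of 4] Y by auto
      have "I 1 \<subseteq> I 2" by (simp add: I_def initial_mono)
      then have "I 1 \<inter> (I 4 - I 2) = {}" by auto
      then show "card (I 1 \<union> (I 4 - I 2)) = 3" using Icard[of 1] Idiff[of 2 4] by (simp add: card_Un_disjoint)
    qed
    also have "cnt layer (\<lambda>K. I 2 \<subseteq> K \<and> x \<notin> K) = N - eps * N"
    proof -
      have "cnt layer (\<lambda>K. I 2 \<subseteq> K) = N"
        using Isub[of 2] Y Icard[of 2] by (intro count_supersets2) auto
      moreover have "cnt layer (\<lambda>K. I 2 \<subseteq> K \<and> x \<in> K) = eps * N"
      proof -
        have "x \<notin> I 2" using Isub[of 2] Y by auto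
        then have "card (insert x (I 2)) = 3" using Icard[of 2] by simp
        then have "cnt layer (\<lambda>K. insert x (I 2) \<subseteq> K) = eps * N"
          using Isub[of 2] Y x by (intro count_supersets3) auto
        then show ?thesis by (simp add: conj_commute)
      qed
      ultimately show ?thesis
        using cnt_split[OF finite_layer, of "\<lambda>K. I 2 \<subseteq> K" "\<lambda>K. x \<in> K"] by simp
    qed
    finally have "real (card A) \<le> N + 24 * (eps\<^sup>2 * N)" by linarith
    then show ?thesis using szA sizes by (simp add: beta_def)
  qed
qed

text \<open>If the pair \<open>u, v\<close> had a larger codegree, then after compression some set of \<open>\<G>\<close> containing \<open>u\<close> and \<open>v\<close> would
  avoid the first two other elements and stay low. Every set of \<open>\<F>\<close> avoiding both \<open>u\<close> and \<open>v\<close> would then contain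
  the first three of these elements, up to a negligible remainder, so little more than \<open>eps * N\<close> sets of \<open>\<F>\<close> are not
  counted by the degrees of \<open>u\<close> and \<open>v\<close>. Two degrees and this term amount to less than the size of \<open>\<F>\<close>.\<close>

lemma codegree_le:
  assumes F: "\<F> \<subseteq> layer" and G: "\<G> \<subseteq> layer" and cr: "cross_intersecting \<F> \<G>"
    and uv: "u \<in> {1..n}" "v \<in> {1..n}" "u \<noteq> v"
    and size: "2 * N + 4 * (eps * N) \<le> real (card \<F>)"
    and deg: "\<And>x. x \<in> {1..n} \<Longrightarrow> cnt \<F> (\<lambda>K. x \<in> K) \<le> N + eps * N + 12 * (eps\<^sup>2 * N)"
  shows "cnt \<G> (\<lambda>K. u \<in> K \<and> v \<in> K) \<le> 12 / 5 * (eps * N)"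
proof (rule ccontr)
  assume "\<not> ?thesis"
  then have big: "12 / 5 * (eps * N) < cnt \<G> (\<lambda>K. u \<in> K \<and> v \<in> K)" by simp
  define Y where "Y = {1..n} - {u, v}"
  have Y: "Y \<subseteq> {1..n}" "finite Y" by (auto simp: Y_def)
  have finF: "finite \<F>" using F finite_layer finite_subset by blast
  have subs: "{K \<in> \<F>. u \<notin> K \<and> v \<notin> K} \<subseteq> layer" "{K \<in> \<G>. u \<in> K \<and> v \<in> K} \<subseteq> layer" using F G by auto
  have cr': "cross_intersecting {K \<in> \<F>. u \<notin> K \<and> v \<notin> K} {K \<in> \<G>. u \<in> K \<and> v \<in> K}"
    using cr by (simp add: cross_intersecting_def)
  have tr: "\<forall>A\<in>{K \<in> \<F>. u \<notin> K \<and> v \<notin> K}. A \<inter> {u, v} = {}"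
    "\<forall>B\<in>{K \<in> \<G>. u \<in> K \<and> v \<in> K}. B \<inter> {u, v} = {u, v}" by auto
  obtain A B where A: "A \<subseteq> layer" and B: "B \<subseteq> layer"
    and cA: "card A = card {K \<in> \<F>. u \<notin> K \<and> v \<notin> K}" and cB: "card B = card {K \<in> \<G>. u \<in> K \<and> v \<in> K}"
    and AB: "cross_intersecting A B" and tA: "\<forall>a\<in>A. a \<inter> {u, v} = {}" and tB: "\<forall>b\<in>B. b \<inter> {u, v} = {u, v}"
    and comp: "compressed_on Y A" "compressed_on Y B"
    unfolding Y_def by (rule compress_pair[OF subs finite_atLeastAtMost cr' tr])
  have T: "{u, v} \<subseteq> {1..n}" "{u, v} \<inter> Y = {}" using uv by (auto simp: Y_def)
  have "\<exists>b\<in>B. \<not> exceeds Y 0 0 1 b"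
  proof (rule ccontr)
    assume "\<not> ?thesis"
    then have *: "{u, v} \<subseteq> b \<and> exceeds Y 0 0 1 b" if "b \<in> B" for b using tB that by blast
    have "cnt B (\<lambda>_. True) \<le> cnt layer (\<lambda>K. {u, v} \<subseteq> K \<and> exceeds Y 0 0 1 K)"
      using * by (intro cnt_mono finite_layer B)
    also have "\<dots> \<le> 12 / 5 * (eps * N)"
      using count_exceeds(3)[OF Y(1) T, of 1 1] uv(3) by (simp add: eval_nat_numeral)
    finally show False using big cB by (simp add: cnt_def)
  qed
  then obtain b where b: "b \<in> B" "\<not> exceeds Y 0 0 1 b" by blast
  have ex: "exceeds Y 1 2 1 a" if "a \<in> A" for a
  proof -
    have "a \<subseteq> {1..n}" "u \<notin> a" "v \<notin> a" using that A tA by (auto simp: nsets_def)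
    then have "a \<inter> b \<subseteq> Y" by (auto simp: Y_def)
    then have "crowded Y a b"
      using crowded_of_cross_intersecting[OF comp(1) AB Y(2) that b(1)] by blast
    then show ?thesis using crowded_exceeds1[OF Y(2) crowded_sym] b(2) by blast
  qed
  have "cnt A (\<lambda>_. True) \<le> cnt layer (\<lambda>K. {} \<subseteq> K \<and> exceeds Y 1 2 1 K)"
    using ex by (intro cnt_mono finite_layer A) simp
  also have "\<dots> \<le> 6 / 5 * (eps * N)"
    using count_exceeds(4)[OF Y(1), of "{}" 1 1] by (simp add: eval_nat_numeral)
  finally have small: "cnt \<F> (\<lambda>K. u \<notin> K \<and> v \<notin> K) \<le> 6 / 5 * (eps * N)"
    using cA by (simp add: cnt_def)
  have "real (card \<F>) = cnt \<F> (\<lambda>_. True)" by (simp add: cnt_def)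
  also have "\<dots> \<le> cnt \<F> (\<lambda>K. u \<in> K) + cnt \<F> (\<lambda>K. v \<in> K \<or> (u \<notin> K \<and> v \<notin> K))"
    by (intro cnt_add_le finF order_refl) blast
  also have "cnt \<F> (\<lambda>K. v \<in> K \<or> (u \<notin> K \<and> v \<notin> K)) \<le> cnt \<F> (\<lambda>K. v \<in> K) + cnt \<F> (\<lambda>K. u \<notin> K \<and> v \<notin> K)"
    by (intro cnt_add_le finF order_refl)
  finally have "real (card \<F>) \<le> 2 * N + 16 / 5 * (eps * N) + 24 * (eps\<^sup>2 * N)"
    using deg[OF uv(1)] deg[OF uv(2)] small by linarith
  then show False using size sizes by linarith
qed

section \<open>Pairs of spread families and their obstructed shifts\<close>

definition spread :: "nat set set \<Rightarrow> bool" where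
  "spread \<F> \<longleftrightarrow> (\<forall>x\<in>{1..n}. beta \<le> cnt \<F> (\<lambda>K. x \<notin> K))"

definition rivals :: "nat set set \<Rightarrow> nat set set \<Rightarrow> bool" where
  "rivals \<F> \<G> \<longleftrightarrow> \<F> \<subseteq> layer \<and> \<G> \<subseteq> layer \<and> cross_intersecting \<F> \<G> \<and>
    2 * N + 4 * (eps * N) \<le> real (card \<F>) \<and> 2 * N + 4 * (eps * N) \<le> real (card \<G>) \<and> spread \<F>"

lemma rivalsD:
  assumes "rivals \<F> \<G>"
  shows "\<F> \<subseteq> layer" "\<G> \<subseteq> layer" "cross_intersecting \<F> \<G>" "finite \<F>" "finite \<G>"
    "2 * N + 4 * (eps * N) \<le> real (card \<F>)" "2 * N + 4 * (eps * N) \<le> real (card \<G>)"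
    "\<And>x. x \<in> {1..n} \<Longrightarrow> beta \<le> cnt \<F> (\<lambda>K. x \<notin> K)"
  using assms finite_layer finite_subset unfolding rivals_def spread_def by blast+

lemma rivals_degree_right:
  assumes "rivals \<F> \<G>" "x \<in> {1..n}"
  shows "cnt \<G> (\<lambda>K. x \<in> K) \<le> N + eps * N + 12 * (eps\<^sup>2 * N)"
  using degree_le[OF rivalsD(1-3)[OF assms(1)] assms(2) rivalsD(8)[OF assms]] .

text \<open>One family being spread forces small degrees in the other one, and since the other one is large, this
  makes it spread as well.\<close>

lemma rivals_sym:
  assumes "rivals \<F> \<G>" shows "rivals \<G> \<F>"
proof -
  have "beta \<le> cnt \<G> (\<lambda>K. x \<notin> K)" if "x \<in> {1..n}" for x
    using rivals_degree_right[OF assms that] cnt_not[OF rivalsD(5)[OF assms], of "\<lambda>K. x \<in> K"]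
      rivalsD(7)[OF assms] sizes unfolding beta_def by linarith
  then show ?thesis
    using assms cross_intersecting_sym unfolding rivals_def spread_def by blast
qed

lemma rivals_codegree:
  assumes "rivals \<F> \<G>" "u \<in> {1..n}" "v \<in> {1..n}" "u \<noteq> v"
  shows "cnt \<G> (\<lambda>K. u \<in> K \<and> v \<in> K) \<le> 12 / 5 * (eps * N)"
  using codegree_le[OF rivalsD(1-3)[OF assms(1)] assms(2-4) rivalsD(6)[OF assms(1)]
      rivals_degree_right[OF rivals_sym[OF assms(1)]]] .

text \<open>A shift from \<open>j\<close> to \<open>i\<close> increases no degree except that of \<open>i\<close>. If it destroys spreadness, then
  fewer than \<open>beta\<close> shifted sets avoid \<open>i\<close>, and sets avoiding both \<open>i\<close> and \<open>j\<close> are among them.\<close>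

lemma rivals_shift_left:
  assumes riv: "rivals \<F> \<G>" and ij: "i < j" "i \<in> {1..n}" "j \<in> {1..n}"
    and bad: "\<not> rivals (shift i j \<F>) (shift i j \<G>)"
  shows "cnt \<F> (\<lambda>K. K \<inter> {i, j} = {}) < beta"
proof -
  note R = rivalsD[OF riv]
  have "shift i j \<F> \<subseteq> layer" by (rule shift_nsets[OF R(1) ij(2)])
  moreover have "shift i j \<G> \<subseteq> layer" by (rule shift_nsets[OF R(2) ij(2)])
  moreover have "cross_intersecting (shift i j \<F>) (shift i j \<G>)" by (rule cross_intersecting_shift[OF R(3)])
  ultimately have "\<not> spread (shift i j \<F>)"
    using bad R(6,7) by (simp add: rivals_def card_shift)
  then obtain x where x: "x \<in> {1..n}" "cnt (shift i j \<F>) (\<lambda>K. x \<notin> K) < beta"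
    unfolding spread_def by (meson not_le)
  have tr: "cnt (shift i j \<F>) (\<lambda>K. x \<notin> K) = cnt \<F> (\<lambda>K. x \<notin> shift_map i j \<F> K)"
    unfolding cnt_def card_shift_filter ..
  have sub: "shift_map i j \<F> K \<subseteq> insert i K" for K by (auto simp: shift_map_def push_def)
  have "x = i"
  proof (rule ccontr)
    assume "x \<noteq> i"
    then have "x \<notin> shift_map i j \<F> K" if "x \<notin> K" for K using sub[of K] that by blast
    then have "cnt \<F> (\<lambda>K. x \<notin> K) \<le> cnt \<F> (\<lambda>K. x \<notin> shift_map i j \<F> K)"
      by (intro cnt_mono R(4) order_refl)
    then show False using R(8)[OF x(1)] x(2) tr by linarith
  qed
  have "i \<notin> shift_map i j \<F> K" if "K \<inter> {i, j} = {}" for K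
  proof -
    have "i \<notin> K" "j \<notin> K" using that by blast+
    then show ?thesis by (simp add: shift_map_def push_def)
  qed
  then have "cnt \<F> (\<lambda>K. K \<inter> {i, j} = {}) \<le> cnt \<F> (\<lambda>K. i \<notin> shift_map i j \<F> K)"
    by (intro cnt_mono R(4) order_refl)
  then show ?thesis using x(2) tr unfolding \<open>x = i\<close> by linarith
qed

lemma rivals_two_pairs:
  assumes riv: "rivals \<F> \<G>" and P: "P \<subseteq> {1..n}" "card P = 2" and Q: "Q \<subseteq> {1..n}" "card Q = 2"
    and dis: "P \<inter> Q = {}"
  shows "cnt \<F> (\<lambda>K. K \<inter> P \<noteq> {} \<and> K \<inter> Q \<noteq> {}) \<le> 48 / 5 * (eps * N)"
proof -
  have fin: "finite (P \<times> Q)" using P Q by (meson finite_SigmaI finite_atLeastAtMost finite_subset)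
  have "cnt \<F> (\<lambda>K. K \<inter> P \<noteq> {} \<and> K \<inter> Q \<noteq> {}) \<le> (\<Sum>p\<in>P \<times> Q. cnt \<F> (\<lambda>K. fst p \<in> K \<and> snd p \<in> K))"
    by (rule cnt_UN_le[OF rivalsD(4)[OF riv] fin]) auto
  also have "\<dots> \<le> (\<Sum>p\<in>P \<times> Q. 12 / 5 * (eps * N))"
  proof (rule sum_mono)
    fix p assume "p \<in> P \<times> Q"
    then have "fst p \<in> {1..n}" "snd p \<in> {1..n}" "fst p \<noteq> snd p" using P Q dis by auto
    then show "cnt \<F> (\<lambda>K. fst p \<in> K \<and> snd p \<in> K) \<le> 12 / 5 * (eps * N)"
      by (rule rivals_codegree[OF rivals_sym[OF riv]])
  qed
  also have "\<dots> = 48 / 5 * (eps * N)" using P(2) Q(2) by (simp add: card_cartesian_product)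
  finally show ?thesis .
qed

text \<open>Each of the three pairs is hit by more than half of the family, so by inclusion-exclusion at least
  \<open>2 * card \<F> - 3 * beta > N\<close> sets, counted with multiplicity, hit two of them. Twelve codegrees cannot
  account for this many.\<close>

lemma no_three_disjoint_pairs:
  assumes riv: "rivals \<F> \<G>"
    and P: "P \<subseteq> {1..n}" "card P = 2" "cnt \<F> (\<lambda>K. K \<inter> P = {}) < beta"
    and Q: "Q \<subseteq> {1..n}" "card Q = 2" "cnt \<F> (\<lambda>K. K \<inter> Q = {}) < beta"
    and R: "R \<subseteq> {1..n}" "card R = 2" "cnt \<F> (\<lambda>K. K \<inter> R = {}) < beta"
    and dis: "P \<inter> Q = {}" "P \<inter> R = {}" "Q \<inter> R = {}"
  shows False
proof -
  note fin = rivalsD(4)[OF riv]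
  have "cnt \<F> (\<lambda>K. K \<inter> P \<noteq> {}) + cnt \<F> (\<lambda>K. K \<inter> Q \<noteq> {}) + cnt \<F> (\<lambda>K. K \<inter> R \<noteq> {})
    \<le> (\<Sum>K\<in>\<F>. 1) + cnt \<F> (\<lambda>K. K \<inter> P \<noteq> {} \<and> K \<inter> Q \<noteq> {}) + cnt \<F> (\<lambda>K. K \<inter> P \<noteq> {} \<and> K \<inter> R \<noteq> {})
      + cnt \<F> (\<lambda>K. K \<inter> Q \<noteq> {} \<and> K \<inter> R \<noteq> {})"
    unfolding cnt_sum[OF fin] sum.distrib[symmetric] by (rule sum_mono) (simp add: of_bool_def)
  moreover have "cnt \<F> (\<lambda>K. K \<inter> S \<noteq> {}) = real (card \<F>) - cnt \<F> (\<lambda>K. K \<inter> S = {})" for S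
    by (rule cnt_not[OF fin])
  ultimately have "2 * real (card \<F>) \<le> 3 * beta + 144 / 5 * (eps * N)"
    using rivals_two_pairs[OF riv P(1,2) Q(1,2) dis(1)] rivals_two_pairs[OF riv P(1,2) R(1,2) dis(2)]
      rivals_two_pairs[OF riv Q(1,2) R(1,2) dis(3)] P(3) Q(3) R(3) by simp
  moreover have "3 * beta = 3 * N + 3 * (eps * N) - 6 * (eps\<^sup>2 * N)" by (simp add: beta_def)
  ultimately show False using rivalsD(6)[OF riv] sizes by linarith
qed

section \<open>Families compressed outside a small set\<close>

text \<open>A set of \<open>\<G>\<close> with trace \<open>{a}\<close> that avoids the first two elements of \<open>Y\<close> and stays low would force
  three early elements on nearly all sets of \<open>\<F>\<close> avoiding \<open>a\<close>, but there are more than \<open>N\<close> of these. So the sets in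
  question contain \<open>a\<close> together with one of the first two elements, which is rare by the codegree
  bound, or contain \<open>a\<close> and two more early elements.\<close>

lemma rivals_single_trace:
  assumes riv: "rivals \<F> \<G>" and X: "X \<subseteq> {1..n}" "card X \<le> 5" and a: "a \<in> X"
    and comp: "compressed_on ({1..n} - X) \<G>"
  shows "cnt \<G> (\<lambda>K. K \<inter> X = {a}) \<le> 29 / 5 * (eps * N) + 24 * (eps\<^sup>2 * N)"
proof -
  define Y where "Y = {1..n} - X"
  define I where "I = initial Y"
  note R = rivalsD[OF riv]
  have Y: "Y \<subseteq> {1..n}" "finite Y" by (auto simp: Y_def)
  have finX: "finite X" using X(1) finite_subset by blast
  have "card Y = n - card X" using X finX by (simp add: Y_def card_Diff_subset)
  then have cY: "4 \<le> card Y" using nk k3 X(2) by simp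
  have aV: "a \<in> {1..n}" "a \<notin> Y" using a X by (auto simp: Y_def)
  have ex: "exceeds Y 0 0 1 b" if b: "b \<in> \<G>" "b \<inter> X = {a}" for b
  proof (rule ccontr)
    assume ne: "\<not> exceeds Y 0 0 1 b"
    have "exceeds Y 1 2 1 K" if K: "K \<in> \<F>" "a \<notin> K" for K
    proof -
      have "b \<subseteq> {1..n}" using b(1) R(2) by (auto simp: nsets_def)
      then have "b \<inter> K \<subseteq> Y" using b(2) K(2) by (auto simp: Y_def)
      then have "crowded Y b K"
        using crowded_of_cross_intersecting[OF comp[folded Y_def] cross_intersecting_sym[OF R(3)] Y(2) b(1) K(1)]
        by blast
      then show ?thesis using crowded_exceeds1[OF Y(2)] ne by blast
    qed
    then have "cnt \<F> (\<lambda>K. a \<notin> K) \<le> cnt layer (\<lambda>K. {} \<subseteq> K \<and> exceeds Y 1 2 1 K)"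
      by (intro cnt_mono finite_layer R(1)) simp
    also have "\<dots> \<le> 6 / 5 * (eps * N)"
      using count_exceeds(4)[OF Y(1), of "{}" 1 1] by (simp add: eval_nat_numeral)
    finally show False using R(8)[OF aV(1)] sizes unfolding beta_def by linarith
  qed
  have I2: "finite (I 2)" "card (I 2) = 2" "I 2 \<subseteq> Y"
    using card_initial_exact[OF Y(1), of 2] cY initial_subset by (auto simp: I_def)
  have I42: "finite (I 4 - I 2)" "card (I 4 - I 2) = 2" "I 4 - I 2 \<subseteq> Y"
    using card_initial_diff[OF Y(1), of 2 4] cY initial_subset by (auto simp: I_def)
  have *: "(\<exists>y\<in>I 2. a \<in> b \<and> y \<in> b) \<or> ({a} \<union> (I 4 - I 2) \<subseteq> b \<or> ({a} \<subseteq> b \<and> exceeds Y 0 0 3 b))"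
    if b: "b \<in> \<G>" "b \<inter> X = {a}" for b
  proof (cases "b \<inter> I 2 = {}")
    case False
    then show ?thesis using b(2) by blast
  next
    case True
    then have "exceeds Y 0 0 2 b"
      using exceeds_cases[OF ex[OF b]] by (simp add: I_def numeral_eq_Suc)
    then consider "2 \<le> card (b \<inter> I 4)" | "exceeds Y 0 0 3 b"
      using exceeds_cases[of Y 0 0 2 b] by (auto simp: I_def numeral_eq_Suc)
    then show ?thesis
    proof cases
      case 1
      then have "2 \<le> card (b \<inter> (I 4 - I 2))"
        using True card_Int_initial_split[OF Y(1), of 2 4 b] by (simp add: I_def)
      then have "I 4 - I 2 \<subseteq> b" using subset_if_card_Int[OF I42(1)] I42(2) by simp
      then show ?thesis using b(2) by blast
    next
      case 2
      then show ?thesis using b(2) by blast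
    qed
  qed
  have "cnt \<G> (\<lambda>K. K \<inter> X = {a}) \<le> cnt \<G> (\<lambda>K. \<exists>y\<in>I 2. a \<in> K \<and> y \<in> K)
      + cnt \<G> (\<lambda>K. {a} \<union> (I 4 - I 2) \<subseteq> K \<or> ({a} \<subseteq> K \<and> exceeds Y 0 0 3 K))"
    by (intro cnt_add_le R(5) order_refl *)
  moreover have "cnt \<G> (\<lambda>K. \<exists>y\<in>I 2. a \<in> K \<and> y \<in> K) \<le> (\<Sum>y\<in>I 2. cnt \<G> (\<lambda>K. a \<in> K \<and> y \<in> K))"
    by (intro cnt_UN_le R(5) I2(1))
  moreover have "(\<Sum>y\<in>I 2. cnt \<G> (\<lambda>K. a \<in> K \<and> y \<in> K)) \<le> (\<Sum>y\<in>I 2. 12 / 5 * (eps * N))"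
    using I2(3) Y(1) aV by (intro sum_mono rivals_codegree[OF riv]) auto
  moreover have "(\<Sum>y\<in>I 2. 12 / 5 * (eps * N)) = 24 / 5 * (eps * N)" using I2(2) by simp
  moreover have "cnt \<G> (\<lambda>K. {a} \<union> (I 4 - I 2) \<subseteq> K \<or> ({a} \<subseteq> K \<and> exceeds Y 0 0 3 K))
     \<le> cnt layer (\<lambda>K. {a} \<union> (I 4 - I 2) \<subseteq> K) + cnt layer (\<lambda>K. {a} \<subseteq> K \<and> exceeds Y 0 0 3 K)"
    by (intro cnt_add_le finite_layer R(2))
  moreover have "cnt layer (\<lambda>K. {a} \<union> (I 4 - I 2) \<subseteq> K) = eps * N"
  proof (rule count_supersets3)
    show "{a} \<union> (I 4 - I 2) \<subseteq> {1..n}" using I42(3) Y(1) aV by blast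
    have "a \<notin> I 4 - I 2" using I42(3) aV by blast
    then show "card ({a} \<union> (I 4 - I 2)) = 3" using I42(1,2) by simp
  qed
  moreover have "cnt layer (\<lambda>K. {a} \<subseteq> K \<and> exceeds Y 0 0 3 K) \<le> 24 * (eps\<^sup>2 * N)"
    using count_exceeds(3)[OF Y(1), of "{a}" 3 2] aV by (simp add: eval_nat_numeral)
  ultimately show ?thesis by linarith
qed

text \<open>A low set of \<open>\<G>\<close> avoiding \<open>X\<close> would force two early elements on nearly every set of \<open>\<F>\<close>, whereas \<open>\<F>\<close> has more
  than \<open>2 * N\<close> members. Hence a set with empty trace contains the first element \<open>y\<close> of \<open>Y\<close> or the next two,
  apart from a small remainder. Sets of the former kind have trace \<open>{y}\<close> on the enlarged
  set \<open>insert y X\<close>, which explains the bound five in \<open>rivals_single_trace\<close>.\<close>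

lemma rivals_empty_trace:
  assumes riv: "rivals \<F> \<G>" and X: "X \<subseteq> {1..n}" "card X \<le> 4"
    and comp: "compressed_on ({1..n} - X) \<G>"
  shows "cnt \<G> (\<lambda>K. K \<inter> X = {}) \<le> 101 / 5 * (eps * N) + 24 * (eps\<^sup>2 * N)"
proof -
  define Y where "Y = {1..n} - X"
  define I where "I = initial Y"
  note R = rivalsD[OF riv]
  have Y: "Y \<subseteq> {1..n}" "finite Y" by (auto simp: Y_def)
  have finX: "finite X" using X(1) finite_subset by blast
  have "card Y = n - card X" using X finX by (simp add: Y_def card_Diff_subset)
  then have cY: "3 \<le> card Y" using nk k3 X(2) by simp
  have ex: "exceeds Y 1 1 0 b" if b: "b \<in> \<G>" "b \<inter> X = {}" for b
  proof (rule ccontr)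
    assume ne: "\<not> exceeds Y 1 1 0 b"
    have "exceeds Y 0 1 1 K" if K: "K \<in> \<F>" for K
    proof -
      have "b \<subseteq> {1..n}" using b(1) R(2) by (auto simp: nsets_def)
      then have "b \<inter> K \<subseteq> Y" using b(2) by (auto simp: Y_def)
      then have "crowded Y b K"
        using crowded_of_cross_intersecting[OF comp[folded Y_def] cross_intersecting_sym[OF R(3)] Y(2) b(1) K]
        by blast
      then show ?thesis using crowded_exceeds0[OF Y(2)] ne by blast
    qed
    then have "cnt \<F> (\<lambda>_. True) \<le> cnt layer (\<lambda>K. {} \<subseteq> K \<and> exceeds Y 0 1 1 K)"
      by (intro cnt_mono finite_layer R(1)) simp
    also have "\<dots> \<le> 6 / 5 * N"
      using count_exceeds(2)[OF Y(1), of "{}" 1 0] by (simp add: eval_nat_numeral)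
    finally have "real (card \<F>) \<le> 6 / 5 * N" by (simp add: cnt_def)
    then show False using R(6) sizes N_pos by linarith
  qed
  have I1: "finite (I 1)" "card (I 1) = 1" "I 1 \<subseteq> Y"
    using card_initial_exact[OF Y(1), of 1] cY initial_subset by (auto simp: I_def)
  then obtain y where y: "I 1 = {y}" by (metis card_1_singletonE)
  have yV: "y \<in> {1..n}" "y \<notin> X" using I1(3) y by (auto simp: Y_def)
  have I31: "finite (I 3 - I 1)" "card (I 3 - I 1) = 2" "I 3 - I 1 \<subseteq> Y"
    using card_initial_diff[OF Y(1), of 1 3] cY initial_subset by (auto simp: I_def)
  obtain u v where uv: "I 3 - I 1 = {u, v}" "u \<noteq> v" using I31(2) by (meson card_2_iff)
  have uvV: "u \<in> {1..n}" "v \<in> {1..n}" using I31(3) uv Y(1) by blast+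
  have *: "b \<inter> insert y X = {y} \<or> ((u \<in> b \<and> v \<in> b) \<or> ({} \<subseteq> b \<and> exceeds Y 1 1 2 b))"
    if b: "b \<in> \<G>" "b \<inter> X = {}" for b
  proof (cases "y \<in> b")
    case True
    then show ?thesis using b(2) by blast
  next
    case False
    then have no: "b \<inter> I 1 = {}" unfolding y by simp
    then have "exceeds Y 1 1 1 b"
      using exceeds_cases[OF ex[OF b]] by (simp add: I_def)
    then consider "2 \<le> card (b \<inter> I 3)" | "exceeds Y 1 1 2 b"
      using exceeds_cases[of Y 1 1 1 b] by (auto simp: I_def numeral_eq_Suc)
    then show ?thesis
    proof cases
      case 1
      then have "2 \<le> card (b \<inter> (I 3 - I 1))"
        using no card_Int_initial_split[OF Y(1), of 1 3 b] by (simp add: I_def)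
      then have "I 3 - I 1 \<subseteq> b" using subset_if_card_Int[OF I31(1)] I31(2) by simp
      then show ?thesis using uv(1) by blast
    next
      case 2
      then show ?thesis by blast
    qed
  qed
  have "cnt \<G> (\<lambda>K. K \<inter> X = {}) \<le> cnt \<G> (\<lambda>K. K \<inter> insert y X = {y})
      + cnt \<G> (\<lambda>K. (u \<in> K \<and> v \<in> K) \<or> ({} \<subseteq> K \<and> exceeds Y 1 1 2 K))"
    by (intro cnt_add_le R(5) order_refl *)
  moreover have "cnt \<G> (\<lambda>K. (u \<in> K \<and> v \<in> K) \<or> ({} \<subseteq> K \<and> exceeds Y 1 1 2 K))
      \<le> cnt \<G> (\<lambda>K. u \<in> K \<and> v \<in> K) + cnt \<G> (\<lambda>K. {} \<subseteq> K \<and> exceeds Y 1 1 2 K)"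
    by (intro cnt_add_le R(5) order_refl)
  moreover have "cnt \<G> (\<lambda>K. {} \<subseteq> K \<and> exceeds Y 1 1 2 K) \<le> cnt layer (\<lambda>K. {} \<subseteq> K \<and> exceeds Y 1 1 2 K)"
    by (intro cnt_mono finite_layer R(2))
  moreover have "cnt layer (\<lambda>K. {} \<subseteq> K \<and> exceeds Y 1 1 2 K) \<le> 12 * (eps * N)"
    using count_exceeds(1)[OF Y(1), of "{}" 2 1] by (simp add: eval_nat_numeral)
  moreover have "cnt \<G> (\<lambda>K. u \<in> K \<and> v \<in> K) \<le> 12 / 5 * (eps * N)"
    by (rule rivals_codegree[OF riv uvV uv(2)])
  moreover have "cnt \<G> (\<lambda>K. K \<inter> insert y X = {y}) \<le> 29 / 5 * (eps * N) + 24 * (eps\<^sup>2 * N)"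
  proof (rule rivals_single_trace[OF riv])
    show "insert y X \<subseteq> {1..n}" "y \<in> insert y X" using X yV by auto
    show "card (insert y X) \<le> 5" using X(2) finX yV by simp
    show "compressed_on ({1..n} - insert y X) \<G>" using comp by (auto simp: compressed_on_def)
  qed
  ultimately show ?thesis by linarith
qed

text \<open>Sorting the sets by the size of their trace on \<open>X\<close> (empty, one element, or containing one of at most six
  pairs) gives at most \<open>61 * eps * N\<close> sets, less than \<open>2 * N \<ge> 78 * eps * N\<close>.\<close>

lemma no_compressed_rivals:
  assumes riv: "rivals \<F> \<G>" and X: "X \<subseteq> {1..n}" "card X \<le> 4"
    and comp: "compressed_on ({1..n} - X) \<G>"
  shows False
proof -
  note R = rivalsD[OF riv]
  have finX: "finite X" using X(1) finite_subset by blast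
  have fin2: "finite (nsets X 2)" by (rule finite_imp_finite_nsets[OF finX])
  have *: "K \<inter> X = {} \<or> (\<exists>a\<in>X. K \<inter> X = {a}) \<or> (\<exists>J\<in>nsets X 2. J \<subseteq> K)" for K
  proof (cases "2 \<le> card (K \<inter> X)")
    case True
    then obtain J where "J \<subseteq> K \<inter> X" "card J = 2" "finite J"
      using obtain_subset_with_card_n[of 2 "K \<inter> X"] by blast
    then have "J \<in> nsets X 2" "J \<subseteq> K" by (auto simp: nsets_def)
    then show ?thesis by blast
  next
    case False
    then have "card (K \<inter> X) = 0 \<or> card (K \<inter> X) = 1" by linarith
    then have "K \<inter> X = {} \<or> (\<exists>a. K \<inter> X = {a})" using finX by (auto simp: card_1_singleton_iff)
    then show ?thesis by blast
  qed
  have "real (card \<G>) = cnt \<G> (\<lambda>_. True)" by (simp add: cnt_def)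
  also have "\<dots> \<le> cnt \<G> (\<lambda>K. K \<inter> X = {}) + cnt \<G> (\<lambda>K. (\<exists>a\<in>X. K \<inter> X = {a}) \<or> (\<exists>J\<in>nsets X 2. J \<subseteq> K))"
    by (intro cnt_add_le R(5) order_refl *)
  also have "cnt \<G> (\<lambda>K. (\<exists>a\<in>X. K \<inter> X = {a}) \<or> (\<exists>J\<in>nsets X 2. J \<subseteq> K))
     \<le> cnt \<G> (\<lambda>K. \<exists>a\<in>X. K \<inter> X = {a}) + cnt \<G> (\<lambda>K. \<exists>J\<in>nsets X 2. J \<subseteq> K)"
    by (intro cnt_add_le R(5) order_refl)
  also have "cnt \<G> (\<lambda>K. \<exists>a\<in>X. K \<inter> X = {a}) \<le> 116 / 5 * (eps * N) + 96 * (eps\<^sup>2 * N)"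
  proof -
    have "cnt \<G> (\<lambda>K. \<exists>a\<in>X. K \<inter> X = {a}) \<le> (\<Sum>a\<in>X. cnt \<G> (\<lambda>K. K \<inter> X = {a}))"
      by (intro cnt_UN_le R(5) finX)
    also have "\<dots> \<le> (\<Sum>a\<in>X. 29 / 5 * (eps * N) + 24 * (eps\<^sup>2 * N))"
      using X comp by (intro sum_mono rivals_single_trace[OF riv]) auto
    also have "\<dots> = real (card X) * (29 / 5 * (eps * N) + 24 * (eps\<^sup>2 * N))" by simp
    also have "\<dots> \<le> 4 * (29 / 5 * (eps * N) + 24 * (eps\<^sup>2 * N))"
      using X(2) sizes by (intro mult_right_mono) auto
    also have "\<dots> = 116 / 5 * (eps * N) + 96 * (eps\<^sup>2 * N)" by (simp add: algebra_simps)
    finally show ?thesis .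
  qed
  also have "cnt \<G> (\<lambda>K. \<exists>J\<in>nsets X 2. J \<subseteq> K) \<le> 72 / 5 * (eps * N)"
  proof -
    have "cnt \<G> (\<lambda>K. \<exists>J\<in>nsets X 2. J \<subseteq> K) \<le> (\<Sum>J\<in>nsets X 2. cnt \<G> (\<lambda>K. J \<subseteq> K))"
      by (intro cnt_UN_le R(5) fin2)
    also have "\<dots> \<le> (\<Sum>J\<in>nsets X 2. 12 / 5 * (eps * N))"
    proof (rule sum_mono)
      fix J assume "J \<in> nsets X 2"
      then obtain u v where J: "J = {u, v}" "u \<noteq> v" "u \<in> X" "v \<in> X"
        by (auto simp: nsets_def card_2_iff)
      have "u \<in> {1..n}" "v \<in> {1..n}" using J X(1) by blast+
      from rivals_codegree[OF riv this J(2)] show "cnt \<G> (\<lambda>K. J \<subseteq> K) \<le> 12 / 5 * (eps * N)"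
        by (simp add: J(1))
    qed
    also have "\<dots> = real (card (nsets X 2)) * (12 / 5 * (eps * N))" by simp
    also have "\<dots> \<le> 6 * (12 / 5 * (eps * N))"
    proof (rule mult_right_mono)
      have "nsets X 2 = {L. L \<subseteq> X \<and> card L = 2}" using finX finite_subset by (auto simp: nsets_def)
      then have "card (nsets X 2) = card X choose 2" using n_subsets[OF finX] by simp
      also have "\<dots> \<le> 4 choose 2" by (rule binomial_left_mono[OF X(2)])
      finally have "card (nsets X 2) \<le> 6" by (simp add: choose_two)
      then show "real (card (nsets X 2)) \<le> 6" by simp
    qed (use sizes in simp)
    also have "\<dots> = 72 / 5 * (eps * N)" by simp
    finally show ?thesis .
  qed
  also note rivals_empty_trace[OF riv X comp]
  finally show False using R(7) sizes by linarith
qed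

text \<open>For an extremal pair, the obstructed shifts are along pairs hit by more than half of the family. No three of
  these pairs are disjoint, so the at most four elements of a maximal set of disjoint ones meet all of them, and
  the families are compressed outside these elements.\<close>

lemma no_rivals: "\<not> rivals \<F> \<G>"
proof
  assume "rivals \<F> \<G>"
  then obtain A B where riv: "rivals A B"
    and st: "\<And>i j. i < j \<Longrightarrow> rivals (shift i j A) (shift i j B) \<Longrightarrow> stable i j A \<and> stable i j B"
  proof (rule ad_extremis)
    show "F \<subseteq> layer \<and> G \<subseteq> layer" if "rivals F G" for F G using rivalsD[OF that] by blast
  qed auto
  define E where "E = {{i, j} |i j. i < j \<and> i \<in> {1..n} \<and> j \<in> {1..n} \<and> \<not> rivals (shift i j A) (shift i j B)}"
  have E: "P \<subseteq> {1..n}" "card P = 2" "cnt A (\<lambda>K. K \<inter> P = {}) < beta" if PE: "P \<in> E" for P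
  proof -
    obtain i j where P: "P = {i, j}" "i < j" "i \<in> {1..n}" "j \<in> {1..n}" "\<not> rivals (shift i j A) (shift i j B)"
      using PE unfolding E_def by blast
    then show "P \<subseteq> {1..n}" "card P = 2" by auto
    show "cnt A (\<lambda>K. K \<inter> P = {}) < beta"
      unfolding P(1) by (rule rivals_shift_left[OF riv P(2-5)])
  qed
  have cover: False if X: "X \<subseteq> {1..n}" "card X \<le> 4" and meet: "\<And>P. P \<in> E \<Longrightarrow> P \<inter> X \<noteq> {}" for X
  proof (rule no_compressed_rivals[OF riv X])
    have "stable i j B" if "i \<in> {1..n} - X" "j \<in> {1..n} - X" "i < j" for i j
    proof (rule ccontr)
      assume "\<not> stable i j B"
      then have "\<not> rivals (shift i j A) (shift i j B)" using st[OF that(3)] by blast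
      then have "{i, j} \<in> E" using that unfolding E_def by blast
      then show False using meet[of "{i, j}"] that(1,2) by blast
    qed
    then show "compressed_on ({1..n} - X) B" by (simp add: compressed_on_def)
  qed
  have "E \<noteq> {}"
  proof
    assume "E = {}" then show False using cover[of "{}"] by simp
  qed
  then obtain P where P: "P \<in> E" by blast
  have "\<exists>Q\<in>E. Q \<inter> P = {}"
  proof (rule ccontr)
    assume "\<not> ?thesis"
    then show False using cover[of P] E(1,2)[OF P] by force
  qed
  then obtain Q where Q: "Q \<in> E" "Q \<inter> P = {}" by blast
  have "\<exists>R\<in>E. R \<inter> (P \<union> Q) = {}"
  proof (rule ccontr)
    assume no: "\<not> ?thesis"
    have "card (P \<union> Q) \<le> 4" using card_Un_le[of P Q] E(2)[OF P] E(2)[OF Q(1)] by simp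
    moreover have "P \<union> Q \<subseteq> {1..n}" using E(1)[OF P] E(1)[OF Q(1)] by simp
    ultimately show False using cover[of "P \<union> Q"] no by blast
  qed
  then obtain S where S: "S \<in> E" "S \<inter> (P \<union> Q) = {}" by blast
  have d: "P \<inter> Q = {}" "P \<inter> S = {}" "Q \<inter> S = {}" using Q(2) S(2) by blast+
  show False by (rule no_three_disjoint_pairs[OF riv E[OF P] E[OF Q(1)] E[OF S(1)] d])
qed

lemma spread_if_small_ratio:
  assumes F: "\<F> \<subseteq> layer" and size: "2 * N + 4 * (eps * N) \<le> real (card \<F>)"
    and ratio: "max_degree_ratio n \<F> \<le> 1 / 2 + eps / 2"
  shows "spread \<F>"
  unfolding spread_def
proof
  fix x assume x: "x \<in> {1..n}"
  have fin: "finite \<F>" using F finite_layer finite_subset by blast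
  have pos: "0 < real (card \<F>)" using size N_pos sizes by linarith
  have "real (card (link \<F> x)) / real (card \<F>) \<le> max_degree_ratio n \<F>"
    unfolding max_degree_ratio_def using x by (intro Max_ge) auto
  then have "cnt \<F> (\<lambda>K. x \<in> K) / real (card \<F>) \<le> 1 / 2 + eps / 2"
    using ratio by (simp add: cnt_def card_link)
  then have "cnt \<F> (\<lambda>K. x \<in> K) \<le> (1 / 2 + eps / 2) * real (card \<F>)"
    using pos by (simp add: pos_divide_le_eq)
  then have "(1 / 2 - eps / 2) * real (card \<F>) \<le> cnt \<F> (\<lambda>K. x \<notin> K)"
    unfolding cnt_not[OF fin] by (simp add: algebra_simps)
  moreover have "(1 / 2 - eps / 2) * (2 * N + 4 * (eps * N)) \<le> (1 / 2 - eps / 2) * real (card \<F>)"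
    using size eps_le eps_pos by (intro mult_left_mono) auto
  moreover have "(1 / 2 - eps / 2) * (2 * N + 4 * (eps * N)) = beta"
    by (simp add: beta_def algebra_simps power2_eq_square)
  ultimately show "beta \<le> cnt \<F> (\<lambda>K. x \<notin> K)" by linarith
qed

end

section \<open>The degree ratio\<close>

theorem theorem1p6:
  fixes n k :: nat and \<F> \<G> :: "nat set set"
  assumes "k \<ge> 3"
    and "n \<ge> 39 * k"
    and "\<F> \<subseteq> nsets {1..n} k"
    and "\<G> \<subseteq> nsets {1..n} k"
    and "cross_intersecting \<F> \<G>"
    and "card \<F> \<ge> 2 * ((n - 2) choose (k - 2)) + 4 * ((n - 3) choose (k - 3))"
    and "card \<G> \<ge> 2 * ((n - 2) choose (k - 2)) + 4 * ((n - 3) choose (k - 3))"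
  shows "min (max_degree_ratio n \<F>) (max_degree_ratio n \<G>)
           > 1 / 2 + (real k - 2) / (2 * (real n - 2))"
proof -
  interpret sparse_layer n k using assms(1,2) by unfold_locales
  have large: "2 * N + 4 * (eps * N) \<le> real (card \<H>)"
    if "2 * ((n - 2) choose (k - 2)) + 4 * ((n - 3) choose (k - 3)) \<le> card \<H>" for \<H> :: "nat set set"
    using of_nat_mono[OF that, where 'a = real] by (simp add: N_def[symmetric] card_third)
  have c: "1 / 2 + (real k - 2) / (2 * (real n - 2)) = 1 / 2 + eps / 2"
    by (simp add: eps_def)
  have F: "\<not> max_degree_ratio n \<F> \<le> 1 / 2 + eps / 2"
    using no_rivals[of \<F> \<G>] spread_if_small_ratio[OF assms(3) large[OF assms(6)]]
      assms(3-5) large[OF assms(6)] large[OF assms(7)] unfolding rivals_def by blast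
  have G: "\<not> max_degree_ratio n \<G> \<le> 1 / 2 + eps / 2"
    using no_rivals[of \<G> \<F>] spread_if_small_ratio[OF assms(4) large[OF assms(7)]]
      assms(3,4) cross_intersecting_sym[OF assms(5)] large[OF assms(6)] large[OF assms(7)]
    unfolding rivals_def by blast
  show ?thesis using F G unfolding c by simp
qed

end
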